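(* Let $d,n\ge1$. Let $x^{(1)},\dots,x^{(n+1)}\in\mathbb{R}^d$ be i.i.d. $\mathcal{N}(0,I_d)$, let $w_\star\sim\mathcal{N}(0,I_d)$ be independent, and $y^{(i)}=\langle x^{(i)},w_\star\rangle$ for $i\le n$. Let $$Z_0=\begin{bmatrix} x^{(1)} & \cdots & x^{(n)} & x^{(n+1)}\\ y^{(1)} & \cdots & y^{(n)} & 0\end{bmatrix},\qquad M=\begin{bmatrix} I_n & 0\\ 0& 0\end{bmatrix}\in\mathbb{R}^{(n+1)\times(n+1)}.$$ For symmetric $A_0,A_1\in\mathbb{R}^{d\times d}$, let $P_i=\begin{bmatrix}0_{d\times d}&0\\0&1\end{bmatrix}$, $Q_i=\begin{bmatrix}A_i&0\\0&0\end{bmatrix}$, $Z_{i+1}=Z_i+\frac1nP_iZ_iM(Z_i^\top Q_iZ_i)$ for $i=0,1$, and $$f(A_0,A_1)=\mathbb{E}\Big[\big([Z_2]_{d+1,n+1}+w_\star^\top x^{(n+1)}\big)^2\Big].$$ Then there are diagonal matrices $A_0$ and $A_1$ that are a global minimizer of $f$ over pairs of symmetric $d\times d$ matrices.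
   Context: $[X]_{i,j}$ denotes the $(i,j)$ entry of a matrix $X$; the expectation is over $x^{(1)},\dots,x^{(n+1)},w_\star$. *)

theory Defs
  imports "HOL-Probability.Probability" "Jordan_Normal_Form.Matrix"
begin

text \<open>Sample space: \<omega> :: nat \<times> nat \<Rightarrow> real.  For c \<le> n, \<omega>(c,j) is the j-th
  coordinate (0-based) of x^(c+1); \<omega>(n+1,j) is the j-th coordinate of w_star.
  All (n+2)*d coordinates are i.i.d. standard normal.\<close>

definition gauss_space :: "nat \<Rightarrow> nat \<Rightarrow> ((nat \<times> nat) \<Rightarrow> real) measure" where
  "gauss_space d n = PiM ({0..n+1} \<times> {0..<d}) (\<lambda>_. density lborel std_normal_density)"

definition xv :: "nat \<Rightarrow> ((nat \<times> nat) \<Rightarrow> real) \<Rightarrow> nat \<Rightarrow> nat \<Rightarrow> real" where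
  "xv d \<omega> c j = \<omega> (c, j)"

definition wstar :: "nat \<Rightarrow> ((nat \<times> nat) \<Rightarrow> real) \<Rightarrow> nat \<Rightarrow> real" where
  "wstar n \<omega> j = \<omega> (n+1, j)"

definition yv :: "nat \<Rightarrow> nat \<Rightarrow> ((nat \<times> nat) \<Rightarrow> real) \<Rightarrow> nat \<Rightarrow> real" where
  "yv d n \<omega> c = (\<Sum>j<d. xv d \<omega> c j * wstar n \<omega> j)"

definition Z0 :: "nat \<Rightarrow> nat \<Rightarrow> ((nat \<times> nat) \<Rightarrow> real) \<Rightarrow> real mat" where
  "Z0 d n \<omega> = mat (d+1) (n+1)
     (\<lambda>(r,c). if r < d then xv d \<omega> c r else if c < n then yv d n \<omega> c else 0)"

definition Mmat :: "nat \<Rightarrow> real mat" where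
  "Mmat n = mat (n+1) (n+1) (\<lambda>(i,j). if i = j \<and> i < n then 1 else 0)"

definition Pmat :: "nat \<Rightarrow> real mat" where
  "Pmat d = mat (d+1) (d+1) (\<lambda>(i,j). if i = d \<and> j = d then 1 else 0)"

definition Qmat :: "nat \<Rightarrow> real mat \<Rightarrow> real mat" where
  "Qmat d A = mat (d+1) (d+1) (\<lambda>(i,j). if i < d \<and> j < d then A $$ (i,j) else 0)"

definition tf_step :: "nat \<Rightarrow> nat \<Rightarrow> real mat \<Rightarrow> real mat \<Rightarrow> real mat" where
  "tf_step d n A Z = Z + (1 / real n) \<cdot>\<^sub>m (Pmat d * Z * Mmat n * (Z\<^sup>T * Qmat d A * Z))"

definition Z2 :: "nat \<Rightarrow> nat \<Rightarrow> real mat \<Rightarrow> real mat \<Rightarrow> ((nat \<times> nat) \<Rightarrow> real) \<Rightarrow> real mat" where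
  "Z2 d n A0 A1 \<omega> = tf_step d n A1 (tf_step d n A0 (Z0 d n \<omega>))"

text \<open>f(A0,A1) = E[([Z_2]_{d+1,n+1} + w_star^T x^(n+1))^2]; the integrand is nonnegative,
  so the expectation is the nonnegative (extended) Lebesgue integral.\<close>
definition loss :: "nat \<Rightarrow> nat \<Rightarrow> real mat \<Rightarrow> real mat \<Rightarrow> ennreal" where
  "loss d n A0 A1 = (\<integral>\<^sup>+ \<omega>. ennreal ((Z2 d n A0 A1 \<omega> $$ (d, n)
       + (\<Sum>j<d. wstar n \<omega> j * xv d \<omega> n j))\<^sup>2) \<partial>gauss_space d n)"

end

theory Submission
  imports Defs
begin

text \<open>Writing $G = \frac1n \sum_{i \le n} x^{(i)} (x^{(i)})^T$, the residual inside the loss is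
  $w_\star^T (I + G A_0)(I + G A_1) x^{(n+1)}$, so only inner products and the two bilinear forms enter.

  An orthogonal change of coordinates applied to all columns preserves the Gaussian measure, hence
  conjugating $A_0$ and $A_1$ simultaneously does not change the loss. Maximising the weighted trace
  $\sum_i i (A_0)_{ii}$ over the (compact) set of pairs with no larger loss makes $A_0$ diagonal, since
  otherwise a small plane reflection would increase it. For diagonal $A_0$ the sign flips of single
  coordinates fix $A_0$, and the loss is convex in $A_1$; averaging over flips makes $A_1$ diagonal.

  A minimizer among diagonal pairs exists because the residual is bilinear in $(1, A_0)$ and $(1, A_1)$
  and, as a polynomial, vanishes only if one of the two factors does. After normalising a minimizing
  sequence, a limit whose first coordinate vanishes would have zero risk by Fatou's lemma.\<close>

section \<open>The residual and its second moment in terms of inner products and bilinear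
  forms\<close>

definition dotp :: "nat \<Rightarrow> (nat \<Rightarrow> real) \<Rightarrow> (nat \<Rightarrow> real) \<Rightarrow> real" where
  "dotp d x y = (\<Sum>i<d. x i * y i)"

definition bform :: "nat \<Rightarrow> (nat \<Rightarrow> nat \<Rightarrow> real) \<Rightarrow> (nat \<Rightarrow> real) \<Rightarrow> (nat \<Rightarrow> real) \<Rightarrow> real" where
  "bform d A x y = dotp d x (\<lambda>i. dotp d (A i) y)"

text \<open>The scalars \<open>\<alpha>\<close> and \<open>\<beta>\<close> stand in for the two identity matrices, making the residual
  bilinear in \<open>(\<alpha>, A)\<close> and \<open>(\<beta>, B)\<close>; the loss is the case \<open>\<alpha> = \<beta> = 1\<close>.\<close>

definition resid :: "nat \<Rightarrow> nat \<Rightarrow> real \<Rightarrow> (nat \<Rightarrow> nat \<Rightarrow> real) \<Rightarrow> real \<Rightarrow> (nat \<Rightarrow> nat \<Rightarrow> real)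
    \<Rightarrow> (nat \<times> nat \<Rightarrow> real) \<Rightarrow> real" where
  "resid d n \<alpha> A \<beta> B \<omega> =
     (let x = \<lambda>c j. \<omega> (c, j); w = x (n+1); v = x n in
      \<alpha> * \<beta> * dotp d w v
      + \<beta> / real n * (\<Sum>c<n. dotp d w (x c) * bform d A (x c) v)
      + \<alpha> / real n * (\<Sum>c<n. dotp d w (x c) * bform d B (x c) v)
      + 1 / (real n)\<^sup>2 * (\<Sum>e<n. (\<Sum>c<n. dotp d w (x c) * bform d A (x c) (x e)) * bform d B (x e) v))"

definition risk :: "nat \<Rightarrow> nat \<Rightarrow> real \<Rightarrow> (nat \<Rightarrow> nat \<Rightarrow> real) \<Rightarrow> real \<Rightarrow> (nat \<Rightarrow> nat \<Rightarrow> real) \<Rightarrow> ennreal" where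
  "risk d n \<alpha> A \<beta> B = (\<integral>\<^sup>+ \<omega>. ennreal ((resid d n \<alpha> A \<beta> B \<omega>)\<^sup>2) \<partial>gauss_space d n)"

section \<open>From the matrix recursion to the closed form of the residual\<close>

lemma bform_sum: "bform d A x y = (\<Sum>i<d. \<Sum>j<d. x i * A i j * y j)"
  by (simp add: bform_def dotp_def sum_distrib_left mult.assoc)

lemma tf_step_carrier: "Z \<in> carrier_mat (d+1) (n+1) \<Longrightarrow> tf_step d n A Z \<in> carrier_mat (d+1) (n+1)"
  by (auto simp: tf_step_def Mmat_def Pmat_def Qmat_def)

text \<open>Left multiplication by \<open>Pmat d\<close> keeps only the label row, so the data rows
  do not change. \<open>Mmat n\<close> removes the query column, so the sum runs over the
  \<open>n\<close> training columns.\<close>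

lemma tf_step_entry:
  assumes Z: "Z \<in> carrier_mat (d+1) (n+1)" and rc: "r < d+1" "c < n+1"
  shows "tf_step d n A Z $$ (r, c) = Z $$ (r, c) + (if r < d then 0 else
     1 / real n * (\<Sum>e<n. Z $$ (d, e) * bform d (\<lambda>i j. A $$ (i, j)) (\<lambda>i. Z $$ (i, e)) (\<lambda>j. Z $$ (j, c))))"
proof -
  define W where "W = Z\<^sup>T * Qmat d A * Z"
  have W: "W \<in> carrier_mat (n+1) (n+1)" unfolding W_def using Z by (auto simp: Qmat_def)
  have ZQ: "(Z\<^sup>T * Qmat d A) $$ (e, j) = (if j < d then \<Sum>i<d. Z $$ (i, e) * A $$ (i, j) else 0)"
    if "e < n+1" "j < d+1" for e j
  proof -
    have "(Z\<^sup>T * Qmat d A) $$ (e, j) =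
      (\<Sum>i = 0..<d+1. Z $$ (i, e) * (if i < d \<and> j < d then A $$ (i,j) else 0))"
      using Z that by (auto simp: Qmat_def scalar_prod_def intro!: sum.cong)
    also have "\<dots> = (if j < d then \<Sum>i<d. Z $$ (i, e) * A $$ (i, j) else 0)"
      by (auto simp: lessThan_atLeast0 intro!: sum.cong)
    finally show ?thesis .
  qed
  have We: "W $$ (e, c) = bform d (\<lambda>i j. A $$ (i, j)) (\<lambda>i. Z $$ (i, e)) (\<lambda>j. Z $$ (j, c))"
    if "e < n+1" for e
  proof -
    have "W $$ (e, c) = (\<Sum>j = 0..<d+1. (Z\<^sup>T * Qmat d A) $$ (e, j) * Z $$ (j, c))"
      unfolding W_def using Z that rc by (subst index_mult_mat) (auto simp: scalar_prod_def Qmat_def simp del: index_mult_mat(1) intro!: sum.cong)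
    also have "\<dots> = (\<Sum>j = 0..<d+1. (if j < d then \<Sum>i<d. Z $$ (i, e) * A $$ (i, j) else 0) * Z $$ (j, c))"
      using ZQ that by (intro sum.cong) auto
    also have "\<dots> = (\<Sum>j<d. (\<Sum>i<d. Z $$ (i, e) * A $$ (i, j)) * Z $$ (j, c))"
      by (auto simp: lessThan_atLeast0 intro!: sum.cong)
    also have "\<dots> = bform d (\<lambda>i j. A $$ (i, j)) (\<lambda>i. Z $$ (i, e)) (\<lambda>j. Z $$ (j, c))"
      unfolding bform_sum by (subst sum.swap) (simp add: sum_distrib_right)
    finally show ?thesis .
  qed
  have PZ: "(Pmat d * Z) $$ (r, e) = (if r = d then Z $$ (d, e) else 0)" if "e < n+1" for e
  proof -
    have "(Pmat d * Z) $$ (r, e) = (\<Sum>i = 0..<d+1. if i = d then (if r = d then Z $$ (d, e) else 0) else 0)"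
      using Z that rc by (auto simp: Pmat_def scalar_prod_def intro!: sum.cong)
    also have "\<dots> = (if r = d then Z $$ (d, e) else 0)" by (subst sum.delta) auto
    finally show ?thesis .
  qed
  have PZM: "(Pmat d * Z * Mmat n) $$ (r, e) = (if r = d \<and> e < n then Z $$ (d, e) else 0)" if "e < n+1" for e
  proof -
    have "(Pmat d * Z * Mmat n) $$ (r, e) = (\<Sum>i = 0..<n+1. (Pmat d * Z) $$ (r, i) * (if i = e \<and> i < n then 1 else 0))"
      using Z that rc by (subst index_mult_mat) (auto simp: Pmat_def Mmat_def scalar_prod_def simp del: index_mult_mat(1) intro!: sum.cong)
    also have "\<dots> = (\<Sum>i = 0..<n+1. if i = e then (if r = d \<and> e < n then Z $$ (d, e) else 0) else 0)"
      using PZ that by (intro sum.cong) auto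
    also have "\<dots> = (if r = d \<and> e < n then Z $$ (d, e) else 0)" using that by (subst sum.delta) auto
    finally show ?thesis .
  qed
  have "(Pmat d * Z * Mmat n * W) $$ (r, c) = (\<Sum>e = 0..<n+1. (Pmat d * Z * Mmat n) $$ (r, e) * W $$ (e, c))"
    using Z W rc by (subst index_mult_mat) (auto simp: Pmat_def Mmat_def scalar_prod_def simp del: index_mult_mat(1) intro!: sum.cong)
  also have "\<dots> = (\<Sum>e = 0..<n+1. (if r = d \<and> e < n then Z $$ (d, e) else 0) * W $$ (e, c))"
    using PZM by (intro sum.cong) auto
  also have "\<dots> = (if r < d then 0 else (\<Sum>e<n. Z $$ (d, e) * W $$ (e, c)))"
    using rc by (auto simp: lessThan_atLeast0 intro!: sum.cong)
  also have "\<dots> = (if r < d then 0 else (\<Sum>e<n. Z $$ (d, e) * bform d (\<lambda>i j. A $$ (i, j)) (\<lambda>i. Z $$ (i, e)) (\<lambda>j. Z $$ (j, c))))"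
    using We by auto
  finally have *: "(Pmat d * Z * Mmat n * W) $$ (r, c) = \<dots>" .
  have "tf_step d n A Z $$ (r, c) = Z $$ (r, c) + 1 / real n * (Pmat d * Z * Mmat n * W) $$ (r, c)"
    using Z W rc unfolding tf_step_def W_def[symmetric]
    by (subst index_add_mat) (auto simp: Pmat_def Mmat_def simp del: index_mult_mat(1))
  then show ?thesis unfolding * by simp
qed

lemma dotp_cong: "(\<And>i. i < d \<Longrightarrow> x i = x' i) \<Longrightarrow> (\<And>i. i < d \<Longrightarrow> y i = y' i) \<Longrightarrow> dotp d x y = dotp d x' y'"
  by (auto simp: dotp_def)

lemma bform_cong:
  "(\<And>i. i < d \<Longrightarrow> x i = x' i) \<Longrightarrow> (\<And>i. i < d \<Longrightarrow> y i = y' i)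
   \<Longrightarrow> (\<And>i j. i < d \<Longrightarrow> j < d \<Longrightarrow> A i j = A' i j) \<Longrightarrow> bform d A x y = bform d A' x' y'"
  by (auto simp: bform_def intro!: dotp_cong)

lemma dotp_commute: "dotp d x y = dotp d y x"
  by (simp add: dotp_def mult.commute)

text \<open>Both steps read the original data rows; only the label row evolves. Its query entry
  starts at 0, and its training entries enter the second step already corrected by the first, which
  produces the term containing both forms.\<close>

lemma Z2_entry:
  assumes "n \<ge> 1"
  shows "Z2 d n A B \<omega> $$ (d, n) + (\<Sum>j<d. wstar n \<omega> j * xv d \<omega> n j)
    = resid d n 1 (\<lambda>i j. A $$ (i, j)) 1 (\<lambda>i j. B $$ (i, j)) \<omega>"
proof -
  define x where "x = (\<lambda>c j. \<omega> (c, j))"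
  define w where "w = x (n+1)"
  let ?A = "bform d (\<lambda>i j. A $$ (i, j))" and ?B = "bform d (\<lambda>i j. B $$ (i, j))"
  define Z where "Z = Z0 d n \<omega>"
  define Z' where "Z' = tf_step d n A Z"
  have Z: "Z \<in> carrier_mat (d+1) (n+1)" by (simp add: Z_def Z0_def)
  have Z': "Z' \<in> carrier_mat (d+1) (n+1)" unfolding Z'_def using Z by (rule tf_step_carrier)
  have x0: "Z $$ (i, c) = x c i" if "i < d" "c \<le> n" for i c
    using that by (simp add: Z_def Z0_def x_def xv_def)
  have y0: "Z $$ (d, c) = (if c < n then dotp d w (x c) else 0)" if "c \<le> n" for c
    using that by (simp add: Z_def Z0_def x_def xv_def w_def yv_def dotp_def wstar_def mult.commute)
  have x1: "Z' $$ (i, c) = x c i" if "i < d" "c \<le> n" for i c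
    using that x0 tf_step_entry[OF Z, of i c A] by (simp add: Z'_def)
  have y1: "Z' $$ (d, c) = Z $$ (d, c) + 1 / real n * (\<Sum>e<n. dotp d w (x e) * ?A (x e) (x c))" if "c \<le> n" for c
    using that x0 y0 tf_step_entry[OF Z, of d c A]
    by (auto simp: Z'_def intro!: sum.cong arg_cong2[where f="(*)"] bform_cong)
  have "Z2 d n A B \<omega> $$ (d, n) = Z' $$ (d, n) + 1 / real n * (\<Sum>e<n. Z' $$ (d, e) * ?B (x e) (x n))"
    using x1 tf_step_entry[OF Z', of d n B]
    by (auto simp: Z2_def Z_def[symmetric] Z'_def[symmetric] intro!: sum.cong arg_cong2[where f="(*)"] bform_cong)
  \<comment> \<open>A training label after the first step is the original label plus a correction,
    so the sum splits into the term in \<open>B\<close> alone and the mixed term.\<close>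
  also have "(\<Sum>e<n. Z' $$ (d, e) * ?B (x e) (x n)) = (\<Sum>e<n. dotp d w (x e) * ?B (x e) (x n))
     + 1 / real n * (\<Sum>e<n. (\<Sum>c<n. dotp d w (x c) * ?A (x c) (x e)) * ?B (x e) (x n))"
    by (simp add: y1 y0 sum.distrib[symmetric] sum_distrib_left algebra_simps)
  also have "Z' $$ (d, n) = 1 / real n * (\<Sum>e<n. dotp d w (x e) * ?A (x e) (x n))"
    by (simp add: y1 y0)
  finally have "Z2 d n A B \<omega> $$ (d, n) = 1 / real n * (\<Sum>e<n. dotp d w (x e) * ?A (x e) (x n))
    + 1 / real n * ((\<Sum>e<n. dotp d w (x e) * ?B (x e) (x n))
     + 1 / real n * (\<Sum>e<n. (\<Sum>c<n. dotp d w (x c) * ?A (x c) (x e)) * ?B (x e) (x n)))" .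
  moreover have "(\<Sum>j<d. wstar n \<omega> j * xv d \<omega> n j) = dotp d w (x n)"
    by (simp add: dotp_def wstar_def xv_def w_def x_def)
  ultimately show ?thesis
    by (simp add: resid_def Let_def w_def x_def[symmetric] algebra_simps power2_eq_square)
qed

lemma loss_eq_risk:
  "n \<ge> 1 \<Longrightarrow> loss d n A B = risk d n 1 (\<lambda>i j. A $$ (i, j)) 1 (\<lambda>i j. B $$ (i, j))"
  unfolding loss_def risk_def by (simp add: Z2_entry)

section \<open>Plane reflections acting on vectors, bilinear forms and samples\<close>

text \<open>Reflections rather than rotations: they are symmetric involutions, and the sign flip of one
  coordinate is the case \<open>a = -1\<close>, \<open>b = 0\<close>.\<close>

definition refl2 :: "nat \<Rightarrow> nat \<Rightarrow> real \<Rightarrow> real \<Rightarrow> (nat \<Rightarrow> real) \<Rightarrow> nat \<Rightarrow> real" where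
  "refl2 p q a b x = (\<lambda>i. if i = p then a * x p + b * x q else if i = q then b * x p - a * x q else x i)"

text \<open>These are the entries of \<open>R A R\<close>, where \<open>R\<close> is the matrix of
  \<open>refl2 p q a b\<close>; \<open>R\<close> is symmetric, so no transpose appears.\<close>

definition conj2 :: "nat \<Rightarrow> nat \<Rightarrow> real \<Rightarrow> real \<Rightarrow> (nat \<Rightarrow> nat \<Rightarrow> real) \<Rightarrow> nat \<Rightarrow> nat \<Rightarrow> real" where
  "conj2 p q a b A = (\<lambda>i j. refl2 p q a b (\<lambda>k. refl2 p q a b (A k) j) i)"

text \<open>The matrix of the reflection is symmetric: its block on \<open>p\<close> and
  \<open>q\<close> is, and elsewhere it is the identity.\<close>

lemma dotp_refl2:
  assumes "p < d" "q < d" "p \<noteq> q"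
  shows "dotp d (refl2 p q a b x) y = dotp d x (refl2 p q a b y)"
proof -
  have *: "dotp d u v = u p * v p + (u q * v q + (\<Sum>i\<in>{..<d} - {p} - {q}. u i * v i))" for u v
    unfolding dotp_def using assms
    by (subst sum.remove[of _ p], simp, simp, subst sum.remove[of _ q]) auto
  have "(\<Sum>i\<in>{..<d} - {p} - {q}. refl2 p q a b x i * y i) = (\<Sum>i\<in>{..<d} - {p} - {q}. x i * refl2 p q a b y i)"
    by (auto simp: refl2_def intro!: sum.cong)
  then show ?thesis
    unfolding * using assms(3) by (simp add: refl2_def algebra_simps)
qed

lemma refl2_involution:
  assumes "p \<noteq> q" "a\<^sup>2 + b\<^sup>2 = 1"
  shows "refl2 p q a b (refl2 p q a b x) = x"
proof -
  have ab: "a * a + b * b = 1" using assms(2) by (simp add: power2_eq_square)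
  have "a * (a * u + b * v) + b * (b * u - a * v) = (a * a + b * b) * u"
    "b * (a * u + b * v) - a * (b * u - a * v) = (a * a + b * b) * v" for u v
    by (simp_all add: algebra_simps)
  then show ?thesis using assms(1) ab by (auto simp: refl2_def fun_eq_iff)
qed

lemma dotp_refl2_refl2:
  assumes "p < d" "q < d" "p \<noteq> q" "a\<^sup>2 + b\<^sup>2 = 1"
  shows "dotp d (refl2 p q a b x) (refl2 p q a b y) = dotp d x y"
  using assms by (simp add: dotp_refl2 refl2_involution)

lemma dotp_refl2_family:
  "dotp d (\<lambda>j. refl2 p q a b (\<lambda>k. f k j) i) y = refl2 p q a b (\<lambda>k. dotp d (f k) y) i"
  by (simp add: refl2_def dotp_def sum.distrib sum_subtractf sum_distrib_left algebra_simps)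

lemma bform_conj2:
  assumes "p < d" "q < d" "p \<noteq> q"
  shows "bform d (conj2 p q a b A) x y = bform d A (refl2 p q a b x) (refl2 p q a b y)"
proof -
  have "bform d A (refl2 p q a b x) (refl2 p q a b y)
    = dotp d x (refl2 p q a b (\<lambda>k. dotp d (refl2 p q a b (A k)) y))"
    unfolding bform_def using assms by (simp add: dotp_refl2)
  also have "\<dots> = bform d (conj2 p q a b A) x y"
    unfolding bform_def conj2_def dotp_refl2_family ..
  finally show ?thesis ..
qed

text \<open>Only the first \<open>m\<close> columns are reflected, which permits an induction adding
  one column at a time; \<open>m = n + 2\<close> reaches every input and the weight vector.\<close>

definition refl_cols :: "nat \<Rightarrow> nat \<Rightarrow> real \<Rightarrow> real \<Rightarrow> nat \<Rightarrow> (nat \<times> nat \<Rightarrow> real) \<Rightarrow> nat \<times> nat \<Rightarrow> real" where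
  "refl_cols p q a b m \<omega> = (\<lambda>(c, j). if c < m then refl2 p q a b (\<lambda>j. \<omega> (c, j)) j else \<omega> (c, j))"

text \<open>The residual sees the sample only through inner products, which a reflection preserves,
  and through bilinear forms, where conjugating the family amounts to reflecting both
  arguments.\<close>

lemma resid_conj2:
  assumes "p < d" "q < d" "p \<noteq> q" "a\<^sup>2 + b\<^sup>2 = 1"
  shows "resid d n \<alpha> (conj2 p q a b A) \<beta> (conj2 p q a b B) \<omega> = resid d n \<alpha> A \<beta> B (refl_cols p q a b (n+2) \<omega>)"
proof -
  have *: "(\<lambda>j. refl_cols p q a b (n+2) \<omega> (c, j)) = refl2 p q a b (\<lambda>j. \<omega> (c, j))" if "c < n + 2" for c
    using that by (simp add: refl_cols_def)
  \<comment> \<open>The same fact with \<open>n + 2\<close> in the \<open>Suc\<close> form that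
    simplification produces, for the columns under the sums.\<close>
  have **: "(\<lambda>j. refl_cols p q a b (Suc (Suc n)) \<omega> (c, j)) = refl2 p q a b (\<lambda>j. \<omega> (c, j))" if "c < n" for c
    using that by (simp add: refl_cols_def)
  show ?thesis using assms
    by (simp add: resid_def Let_def *[simplified] ** bform_conj2 dotp_refl2_refl2 cong: sum.cong_simp)
qed

section \<open>Invariance of the Gaussian measure under reflections\<close>

abbreviation stdn :: "real measure" where
  "stdn \<equiv> density lborel std_normal_density"

lemma prob_space_stdn: "prob_space stdn"
  by (rule prob_space_normal_density) simp

lemma product_sigma_finite_stdn: "product_sigma_finite (\<lambda>_. stdn)"
  by (simp add: product_sigma_finite_def prob_space_imp_sigma_finite prob_space_stdn)

text \<open>The reflection is a composition of two affine substitutions in one variable each,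
  first \<open>u = a s + b t\<close> for fixed \<open>t\<close>, then \<open>v = (b u - t) / a\<close> for fixed \<open>u\<close>.\<close>

lemma nn_integral_lborel2_reflect:
  fixes h :: "real \<Rightarrow> real \<Rightarrow> ennreal"
  assumes h: "(\<lambda>z. h (fst z) (snd z)) \<in> borel_measurable (borel \<Otimes>\<^sub>M borel)" and ab: "a\<^sup>2 + b\<^sup>2 = 1" "a \<noteq> 0"
  shows "(\<integral>\<^sup>+t. \<integral>\<^sup>+s. h (a * s + b * t) (b * s - a * t) \<partial>lborel \<partial>lborel) = (\<integral>\<^sup>+t. \<integral>\<^sup>+s. h s t \<partial>lborel \<partial>lborel)"
proof -
  have hm: "(\<lambda>x. h (f x) (g x)) \<in> borel_measurable M" if "f \<in> borel_measurable M" "g \<in> borel_measurable M"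
    for f g :: "'b \<Rightarrow> real" and M
    using measurable_compose[OF measurable_Pair[OF that] h] by simp
  \<comment> \<open>Here \<open>a\<^sup>2 + b\<^sup>2 = 1\<close> enters: along the first
    substitution, the argument of the second is the reflected second coordinate.\<close>
  have *: "b * (b * t + a * s) - t = a * (b * s - a * t)" for s t
  proof -
    have "b * (b * t + a * s) - t = a * b * s - (1 - b * b) * t" by (simp add: algebra_simps)
    also have "1 - b * b = a * a" using ab by (simp add: power2_eq_square)
    finally show ?thesis by (simp add: algebra_simps)
  qed
  have 1: "(\<integral>\<^sup>+u. h u ((b * u - t) / a) \<partial>lborel) = ennreal \<bar>a\<bar> * (\<integral>\<^sup>+s. h (a * s + b * t) (b * s - a * t) \<partial>lborel)" for t
  proof -
    have "(\<integral>\<^sup>+u. h u ((b * u - t) / a) \<partial>lborel)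
        = ennreal \<bar>a\<bar> * (\<integral>\<^sup>+s. h (b * t + a * s) ((b * (b * t + a * s) - t) / a) \<partial>lborel)"
      by (rule nn_integral_real_affine) (use ab in \<open>auto intro!: hm\<close>)
    then show ?thesis unfolding * using ab(2) by (simp add: add.commute)
  qed
  have 2: "(\<integral>\<^sup>+v. h u v \<partial>lborel) = ennreal \<bar>1 / a\<bar> * (\<integral>\<^sup>+t. h u ((b * u - t) / a) \<partial>lborel)" for u
    using ab by (subst nn_integral_real_affine[where c="- 1 / a" and t="b * u / a"])
      (auto intro!: hm simp: diff_divide_distrib)
  \<comment> \<open>The scaling factors of the two substitutions cancel.\<close>
  have inv: "ennreal (1 / \<bar>a\<bar>) * ennreal \<bar>a\<bar> = 1"
    using ab by (simp add: ennreal_mult[symmetric])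
  have "(\<integral>\<^sup>+t. \<integral>\<^sup>+s. h s t \<partial>lborel \<partial>lborel) = (\<integral>\<^sup>+u. \<integral>\<^sup>+v. h u v \<partial>lborel \<partial>lborel)"
    by (rule lborel_pair.Fubini') (simp add: case_prod_beta', rule hm, auto)
  also have "\<dots> = ennreal \<bar>1 / a\<bar> * (\<integral>\<^sup>+u. \<integral>\<^sup>+t. h u ((b * u - t) / a) \<partial>lborel \<partial>lborel)"
    unfolding 2 by (rule nn_integral_cmult) (intro lborel.borel_measurable_nn_integral, simp add: case_prod_beta', rule hm, auto)
  also have "(\<integral>\<^sup>+u. \<integral>\<^sup>+t. h u ((b * u - t) / a) \<partial>lborel \<partial>lborel) = (\<integral>\<^sup>+t. \<integral>\<^sup>+u. h u ((b * u - t) / a) \<partial>lborel \<partial>lborel)"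
    by (rule lborel_pair.Fubini') (simp add: case_prod_beta', rule hm, auto)
  also have "\<dots> = ennreal \<bar>a\<bar> * (\<integral>\<^sup>+t. \<integral>\<^sup>+s. h (a * s + b * t) (b * s - a * t) \<partial>lborel \<partial>lborel)"
    unfolding 1 by (rule nn_integral_cmult) (intro lborel.borel_measurable_nn_integral, simp add: case_prod_beta', rule hm, auto)
  finally show ?thesis by (simp add: mult.assoc[symmetric] inv)
qed

text \<open>The joint density of two standard normals depends only on
  \<open>s\<^sup>2 + t\<^sup>2\<close>, which the reflection preserves. Absorbing it into the
  integrand leaves the Lebesgue case.\<close>

lemma nn_integral_stdn2_reflect:
  fixes h :: "real \<Rightarrow> real \<Rightarrow> ennreal"
  assumes h: "(\<lambda>z. h (fst z) (snd z)) \<in> borel_measurable (borel \<Otimes>\<^sub>M borel)" and ab: "a\<^sup>2 + b\<^sup>2 = 1" "a \<noteq> 0"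
  shows "(\<integral>\<^sup>+t. \<integral>\<^sup>+s. h (a * s + b * t) (b * s - a * t) \<partial>stdn \<partial>stdn) = (\<integral>\<^sup>+t. \<integral>\<^sup>+s. h s t \<partial>stdn \<partial>stdn)"
proof -
  have hm: "(\<lambda>x. h (f x) (g x)) \<in> borel_measurable M" if "f \<in> borel_measurable M" "g \<in> borel_measurable M"
    for f g :: "'b \<Rightarrow> real" and M
    using measurable_compose[OF measurable_Pair[OF that] h] by simp
  define H where "H = (\<lambda>s t. ennreal (exp (- (s\<^sup>2 + t\<^sup>2) / 2) / (2 * pi)) * h s t)"
  have dens: "std_normal_density t * std_normal_density s = exp (- (s\<^sup>2 + t\<^sup>2) / 2) / (2 * pi)" for s t
    by (simp add: std_normal_density_def mult_exp_exp add_divide_distrib diff_divide_distrib real_sqrt_mult_self)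
  \<comment> \<open>The arguments \<open>f\<close> and \<open>g\<close> are kept general so that one
    computation serves the reflected and the plain integrand.\<close>
  have unf: "(\<integral>\<^sup>+t. \<integral>\<^sup>+s. h (f s t) (g s t) \<partial>stdn \<partial>stdn)
      = (\<integral>\<^sup>+t. \<integral>\<^sup>+s. ennreal (exp (- (s\<^sup>2 + t\<^sup>2) / 2) / (2 * pi)) * h (f s t) (g s t) \<partial>lborel \<partial>lborel)"
    if f: "(\<lambda>z. f (fst z) (snd z)) \<in> borel_measurable (borel \<Otimes>\<^sub>M borel)"
     and g: "(\<lambda>z. g (fst z) (snd z)) \<in> borel_measurable (borel \<Otimes>\<^sub>M borel)" for f g
  proof -
    have f': "(\<lambda>s. f s t) \<in> borel_measurable borel" "(\<lambda>s. g s t) \<in> borel_measurable borel" for t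
      using measurable_compose[OF _ f, of "\<lambda>s. (s, t)" borel] measurable_compose[OF _ g, of "\<lambda>s. (s, t)" borel] by auto
    have m2: "(\<lambda>t. \<integral>\<^sup>+s. ennreal (std_normal_density s) * h (f s t) (g s t) \<partial>lborel) \<in> borel_measurable borel"
      using measurable_compose[OF _ f, of "\<lambda>z. (snd z, fst z)" "borel \<Otimes>\<^sub>M borel"]
        measurable_compose[OF _ g, of "\<lambda>z. (snd z, fst z)" "borel \<Otimes>\<^sub>M borel"]
      by (intro lborel.borel_measurable_nn_integral) (simp add: case_prod_beta', intro borel_measurable_times_ennreal hm, auto)
    have "(\<integral>\<^sup>+t. \<integral>\<^sup>+s. h (f s t) (g s t) \<partial>stdn \<partial>stdn)
       = (\<integral>\<^sup>+t. \<integral>\<^sup>+s. ennreal (std_normal_density s) * h (f s t) (g s t) \<partial>lborel \<partial>stdn)"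
      using f' by (subst nn_integral_density) (auto intro!: hm)
    also have "\<dots> = (\<integral>\<^sup>+t. ennreal (std_normal_density t) * (\<integral>\<^sup>+s. ennreal (std_normal_density s) * h (f s t) (g s t) \<partial>lborel) \<partial>lborel)"
      using m2 by (subst nn_integral_density) auto
    also have "\<dots> = (\<integral>\<^sup>+t. \<integral>\<^sup>+s. ennreal (std_normal_density t) * (ennreal (std_normal_density s) * h (f s t) (g s t)) \<partial>lborel \<partial>lborel)"
      using f' by (subst nn_integral_cmult) (auto intro!: hm borel_measurable_times_ennreal)
    finally show ?thesis by (simp add: mult.assoc[symmetric] ennreal_mult[symmetric] dens)
  qed
  have eqH: "ennreal (exp (- (s\<^sup>2 + t\<^sup>2) / 2) / (2 * pi)) * h (a * s + b * t) (b * s - a * t) = H (a * s + b * t) (b * s - a * t)" for s t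
  proof -
    have "(a * s + b * t)\<^sup>2 + (b * s - a * t)\<^sup>2 = (a\<^sup>2 + b\<^sup>2) * (s\<^sup>2 + t\<^sup>2)"
      by (simp add: power2_eq_square algebra_simps)
    then have "(a * s + b * t)\<^sup>2 + (b * s - a * t)\<^sup>2 = s\<^sup>2 + t\<^sup>2" using ab by simp
    then show ?thesis unfolding H_def by (rule arg_cong[where f="\<lambda>r. ennreal (exp (- r / 2) / (2 * pi)) * _", OF sym])
  qed
  have Hm: "(\<lambda>z. H (fst z) (snd z)) \<in> borel_measurable (borel \<Otimes>\<^sub>M borel)"
    unfolding H_def by (rule borel_measurable_times_ennreal[OF _ hm]) measurable
  have "(\<integral>\<^sup>+t. \<integral>\<^sup>+s. h (a * s + b * t) (b * s - a * t) \<partial>stdn \<partial>stdn)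
     = (\<integral>\<^sup>+t. \<integral>\<^sup>+s. H (a * s + b * t) (b * s - a * t) \<partial>lborel \<partial>lborel)"
    unfolding eqH[symmetric] by (rule unf) auto
  also have "\<dots> = (\<integral>\<^sup>+t. \<integral>\<^sup>+s. H s t \<partial>lborel \<partial>lborel)"
    by (rule nn_integral_lborel2_reflect[OF Hm ab])
  also have "\<dots> = (\<integral>\<^sup>+t. \<integral>\<^sup>+s. h s t \<partial>stdn \<partial>stdn)"
    by (subst unf) (auto simp: H_def)
  finally show ?thesis .
qed

text \<open>Two coordinate updates reflect a single column; in this form measurability follows from
  that of function update, and only two factors of the product measure are affected.\<close>

definition refl_col :: "nat \<Rightarrow> nat \<Rightarrow> real \<Rightarrow> real \<Rightarrow> nat \<Rightarrow> (nat \<times> nat \<Rightarrow> real) \<Rightarrow> nat \<times> nat \<Rightarrow> real" where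
  "refl_col p q a b c \<omega> = fun_upd (fun_upd \<omega> (c, p) (a * \<omega> (c, p) + b * \<omega> (c, q)))
     (c, q) (b * \<omega> (c, p) - a * \<omega> (c, q))"

lemma refl_col_measurable:
  assumes "p < d" "q < d" "c < n + 2"
  shows "refl_col p q a b c \<in> gauss_space d n \<rightarrow>\<^sub>M gauss_space d n"
proof -
  let ?I = "{0..n+1} \<times> {0..<d}"
  have mem: "(c, p) \<in> ?I" "(c, q) \<in> ?I" using assms by auto
  have comp: "(\<lambda>\<omega>. \<omega> i) \<in> borel_measurable (PiM ?I (\<lambda>_. stdn))" if "i \<in> ?I" for i
    using measurable_component_singleton[OF that, of "\<lambda>_. stdn"] by simp
  have "(\<lambda>\<omega>. a * \<omega> (c, p) + b * \<omega> (c, q)) \<in> borel_measurable (PiM ?I (\<lambda>_. stdn))"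
    "(\<lambda>\<omega>. b * \<omega> (c, p) - a * \<omega> (c, q)) \<in> borel_measurable (PiM ?I (\<lambda>_. stdn))"
    by (intro borel_measurable_add borel_measurable_diff borel_measurable_times borel_measurable_const comp mem)+
  then have m: "(\<lambda>\<omega>. a * \<omega> (c, p) + b * \<omega> (c, q)) \<in> PiM ?I (\<lambda>_. stdn) \<rightarrow>\<^sub>M stdn"
    "(\<lambda>\<omega>. b * \<omega> (c, p) - a * \<omega> (c, q)) \<in> PiM ?I (\<lambda>_. stdn) \<rightarrow>\<^sub>M stdn"
    by simp_all
  have I: "?I = ?I \<union> {(c, p)}" "?I = ?I \<union> {(c, q)}" using mem by blast+
  show ?thesis
    unfolding refl_col_def[abs_def] gauss_space_def
    by (rule measurable_fun_upd[OF I(2) measurable_fun_upd[OF I(1) measurable_ident m(1)] m(2), unfolded id_apply])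
qed

text \<open>Fubini isolates the two affected coordinates; with the others frozen, the claim is the
  planar one.\<close>

lemma nn_integral_gauss_space_refl_col:
  assumes "p < d" "q < d" "p \<noteq> q" "c < n + 2" and ab: "a\<^sup>2 + b\<^sup>2 = 1" "a \<noteq> 0"
    and F: "F \<in> borel_measurable (gauss_space d n)"
  shows "(\<integral>\<^sup>+\<omega>. F (refl_col p q a b c \<omega>) \<partial>gauss_space d n)
    = (\<integral>\<^sup>+\<omega>. F \<omega> \<partial>gauss_space d n)"
proof -
  interpret product_sigma_finite "\<lambda>_::nat \<times> nat. stdn" by (rule product_sigma_finite_stdn)
  let ?I = "{0..n+1} \<times> {0..<d}"
  define u where "u = (c, p)"
  define v where "v = (c, q)"
  define J where "J = ?I - {u, v}"
  have I: "?I = insert u (insert v J)" and uv: "u \<noteq> v" "u \<notin> insert v J" "v \<notin> J" "finite J"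
    using assms by (auto simp: u_def v_def J_def)
  define S where "S = (\<lambda>\<omega>::nat \<times> nat \<Rightarrow> real. 
    fun_upd (fun_upd \<omega> u (a * \<omega> u + b * \<omega> v)) v (b * \<omega> u - a * \<omega> v))"
  have S_eq: "S = refl_col p q a b c" unfolding S_def refl_col_def[abs_def] u_def v_def ..
  have S: "S \<in> gauss_space d n \<rightarrow>\<^sub>M gauss_space d n"
    unfolding S_eq using assms(1,2,4) by (rule refl_col_measurable)
  \<comment> \<open>The coordinate \<open>u\<close> is integrated innermost, then \<open>v\<close>,
    then all the others.\<close>
  have split2: "(\<integral>\<^sup>+\<omega>. G \<omega> \<partial>gauss_space d n) = (\<integral>\<^sup>+x. \<integral>\<^sup>+t. \<integral>\<^sup>+s. G (x(v := t, u := s)) \<partial>stdn \<partial>stdn \<partial>PiM J (\<lambda>_. stdn))"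
    if G: "G \<in> borel_measurable (gauss_space d n)" for G
  proof -
    have 1: "(\<lambda>(x, s). G (x(u := s))) \<in> borel_measurable (PiM (insert v J) (\<lambda>_. stdn) \<Otimes>\<^sub>M stdn)"
      using G unfolding gauss_space_def I
      by (auto simp: case_prod_beta' intro!: measurable_compose[OF _ G[unfolded gauss_space_def I]] measurable_fun_upd[where J="insert v J"])
    have 2: "(\<lambda>x. \<integral>\<^sup>+s. G (x(u := s)) \<partial>stdn) \<in> borel_measurable (PiM (insert v J) (\<lambda>_. stdn))"
      using sigma_finite_measure.borel_measurable_nn_integral[OF sigma_finite_measures 1] by simp
    have G': "G \<in> borel_measurable (PiM (insert u (insert v J)) (\<lambda>_. stdn))"
      using G unfolding gauss_space_def I .
    show ?thesis
      unfolding gauss_space_def I using uv G' 2 by (simp add: product_nn_integral_insert)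
  qed
  have hm: "(\<lambda>z. F (x(v := snd z, u := fst z))) \<in> borel_measurable (borel \<Otimes>\<^sub>M borel)" if "x \<in> space (PiM J (\<lambda>_. stdn))" for x
  proof -
    have "(\<lambda>z. x(v := snd z, u := fst z)) \<in> borel \<Otimes>\<^sub>M borel \<rightarrow>\<^sub>M PiM (insert u (insert v J)) (\<lambda>_. stdn)"
      by (rule measurable_fun_upd[where J="insert v J"], blast, rule measurable_fun_upd[where J=J], blast)
        (use that in auto)
    from measurable_compose[OF this] F show ?thesis unfolding gauss_space_def I by blast
  qed
  have "(\<integral>\<^sup>+\<omega>. F (S \<omega>) \<partial>gauss_space d n)
    = (\<integral>\<^sup>+x. \<integral>\<^sup>+t. \<integral>\<^sup>+s. F (x(v := b * s - a * t, u := a * s + b * t)) \<partial>stdn \<partial>stdn \<partial>PiM J (\<lambda>_. stdn))"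
    unfolding split2[OF measurable_compose[OF S F]] using uv(1)
    by (simp add: S_def fun_upd_twist)
  also have "\<dots> = (\<integral>\<^sup>+x. \<integral>\<^sup>+t. \<integral>\<^sup>+s. F (x(v := t, u := s)) \<partial>stdn \<partial>stdn \<partial>PiM J (\<lambda>_. stdn))"
    by (intro nn_integral_cong nn_integral_stdn2_reflect[OF hm ab])
  also have "\<dots> = (\<integral>\<^sup>+\<omega>. F \<omega> \<partial>gauss_space d n)"
    by (rule split2[OF F, symmetric])
  finally show ?thesis unfolding S_eq .
qed

lemma refl_cols_Suc:
  assumes "p \<noteq> q"
  shows "refl_cols p q a b (Suc m) \<omega> = refl_col p q a b m (refl_cols p q a b m \<omega>)"
  using assms by (auto simp: refl_cols_def refl_col_def refl2_def fun_eq_iff)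

text \<open>Columns are peeled off by induction: the hypothesis is applied to \<open>F\<close>
  composed with the reflection of column \<open>m\<close>, which is why \<open>F\<close> is
  generalised.\<close>

lemma nn_integral_gauss_space_refl_cols:
  assumes "p < d" "q < d" "p \<noteq> q" and ab: "a\<^sup>2 + b\<^sup>2 = 1" "a \<noteq> 0" and "m \<le> n + 2"
    and F: "F \<in> borel_measurable (gauss_space d n)"
  shows "(\<integral>\<^sup>+\<omega>. F (refl_cols p q a b m \<omega>) \<partial>gauss_space d n) = (\<integral>\<^sup>+\<omega>. F \<omega> \<partial>gauss_space d n)"
  using assms(6,7)
proof (induction m arbitrary: F)
  case 0
  then show ?case by (simp add: refl_cols_def)
next
  case (Suc m)
  have m: "m < n + 2" using Suc.prems by simp
  show ?case
    unfolding refl_cols_Suc[OF assms(3)]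
    using Suc.IH[OF _ measurable_compose[OF refl_col_measurable[OF assms(1,2) m] Suc.prems(2)], of a b]
      nn_integral_gauss_space_refl_col[OF assms(1-3) m ab Suc.prems(2)] m
    by simp
qed

section \<open>Measurability, invariance, homogeneity and lower semicontinuity of the risk\<close>

lemma gauss_space_component:
  "c < n + 2 \<Longrightarrow> j < d \<Longrightarrow> (\<lambda>\<omega>. \<omega> (c, j)) \<in> borel_measurable (gauss_space d n)"
  using measurable_component_singleton[of "(c, j)" "{0..n+1} \<times> {0..<d}" "\<lambda>_. stdn"]
  by (auto simp: gauss_space_def)

lemma resid_measurable: "resid d n \<alpha> A \<beta> B \<in> borel_measurable (gauss_space d n)"
  unfolding resid_def Let_def bform_def dotp_def
  by (intro borel_measurable_add borel_measurable_times borel_measurable_sum borel_measurable_const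
      gauss_space_component) auto

lemma resid_sq_measurable: "(\<lambda>\<omega>. ennreal ((resid d n \<alpha> A \<beta> B \<omega>)\<^sup>2)) \<in> borel_measurable (gauss_space d n)"
  using resid_measurable by (intro measurable_compose[OF _ measurable_ennreal] borel_measurable_power)

lemma risk_conj2:
  assumes "p < d" "q < d" "p \<noteq> q" "a\<^sup>2 + b\<^sup>2 = 1" "a \<noteq> 0"
  shows "risk d n \<alpha> (conj2 p q a b A) \<beta> (conj2 p q a b B) = risk d n \<alpha> A \<beta> B"
  unfolding risk_def resid_conj2[OF assms(1-4)]
  by (rule nn_integral_gauss_space_refl_cols[OF assms le_refl resid_sq_measurable])

text \<open>The residual is homogeneous of degree one in each of the two scalar-family pairs. This
  lets a minimizing sequence be normalised and its limit be scaled back.\<close>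

lemma risk_scale:
  "risk d n (s * \<alpha>) (\<lambda>i j. s * A i j) (t * \<beta>) (\<lambda>i j. t * B i j) = ennreal (s\<^sup>2 * t\<^sup>2) * risk d n \<alpha> A \<beta> B"
proof -
  have "bform d (\<lambda>i j. r * A i j) x y = r * bform d A x y" for r A x y
    by (simp add: bform_sum sum_distrib_left algebra_simps)
  then have bf: "bform d (\<lambda>i j. r * A i j) = (\<lambda>x y. r * bform d A x y)" for r A
    by (simp add: fun_eq_iff)
  have p1: "(\<Sum>c<n. f c * (r * g c)) = r * (\<Sum>c<n. f c * g c)" for f g and r :: real
    by (simp add: sum_distrib_left mult_ac)
  have p2: "(\<Sum>c<n. r * f c * g c) = r * (\<Sum>c<n. f c * g c)" for f g and r :: real
    by (simp add: sum_distrib_left mult_ac)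
  have scal: "(s * \<alpha>) * (t * \<beta>) * P + t * \<beta> / r * (s * Q) + s * \<alpha> / r * (t * R) + 1 / r\<^sup>2 * (t * (s * W))
    = s * t * (\<alpha> * \<beta> * P + \<beta> / r * Q + \<alpha> / r * R + 1 / r\<^sup>2 * W)" for P Q R W r :: real
    by (simp add: divide_inverse distrib_left mult_ac)
  have "resid d n (s * \<alpha>) (\<lambda>i j. s * A i j) (t * \<beta>) (\<lambda>i j. t * B i j) \<omega> = s * t * resid d n \<alpha> A \<beta> B \<omega>" for \<omega>
    unfolding resid_def Let_def bf p1 p2 by (rule scal)
  then show ?thesis
    by (simp add: risk_def power_mult_distrib ennreal_mult nn_integral_cmult resid_sq_measurable)
qed

lemma risk_cong:
  assumes "\<And>i j. i < d \<Longrightarrow> j < d \<Longrightarrow> A i j = A' i j" "\<And>i j. i < d \<Longrightarrow> j < d \<Longrightarrow> B i j = B' i j"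
  shows "risk d n \<alpha> A \<beta> B = risk d n \<alpha> A' \<beta> B'"
proof -
  have "bform d A x y = bform d A' x y" "bform d B x y = bform d B' x y" for x y
    using assms by (auto intro!: bform_cong)
  then show ?thesis by (simp add: risk_def resid_def)
qed

text \<open>The residual converges at every sample, so Fatou's lemma applies. Lower semicontinuity
  suffices for both compactness arguments, and no integrable dominating function has to be
  found.\<close>

lemma risk_liminf:
  assumes lim: "\<alpha> \<longlonglongrightarrow> \<alpha>'" "\<And>i j. i < d \<Longrightarrow> j < d \<Longrightarrow> (\<lambda>k. A k i j) \<longlonglongrightarrow> A' i j"
     "\<beta> \<longlonglongrightarrow> \<beta>'" "\<And>i j. i < d \<Longrightarrow> j < d \<Longrightarrow> (\<lambda>k. B k i j) \<longlonglongrightarrow> B' i j"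
  shows "risk d n \<alpha>' A' \<beta>' B' \<le> liminf (\<lambda>k. risk d n (\<alpha> k) (A k) (\<beta> k) (B k))"
proof -
  have bA: "(\<lambda>k. bform d (A k) x y) \<longlonglongrightarrow> bform d A' x y" and bB: "(\<lambda>k. bform d (B k) x y) \<longlonglongrightarrow> bform d B' x y" for x y
    unfolding bform_sum by (intro tendsto_intros lim; simp)+
  have "(\<lambda>k. resid d n (\<alpha> k) (A k) (\<beta> k) (B k) \<omega>) \<longlonglongrightarrow> resid d n \<alpha>' A' \<beta>' B' \<omega>" for \<omega>
    unfolding resid_def Let_def divide_inverse by (intro tendsto_intros bA bB lim)
  then have "(\<lambda>k. ennreal ((resid d n (\<alpha> k) (A k) (\<beta> k) (B k) \<omega>)\<^sup>2)) \<longlonglongrightarrow> ennreal ((resid d n \<alpha>' A' \<beta>' B' \<omega>)\<^sup>2)" for \<omega>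
    by (intro tendsto_ennrealI tendsto_power)
  then have "risk d n \<alpha>' A' \<beta>' B' = (\<integral>\<^sup>+\<omega>. liminf (\<lambda>k. ennreal ((resid d n (\<alpha> k) (A k) (\<beta> k) (B k) \<omega>)\<^sup>2)) \<partial>gauss_space d n)"
    unfolding risk_def by (intro nn_integral_cong lim_imp_Liminf[OF sequentially_bot, symmetric])
  also have "\<dots> \<le> liminf (\<lambda>k. risk d n (\<alpha> k) (A k) (\<beta> k) (B k))"
    unfolding risk_def by (intro nn_integral_liminf resid_sq_measurable)
  finally show ?thesis .
qed

text \<open>Subsequences are extracted one index at a time; passing to a further subsequence keeps
  the limits already obtained.\<close>

lemma bounded_seqs_common_subseq:
  fixes f :: "'i \<Rightarrow> nat \<Rightarrow> real"
  assumes "finite I" "\<And>i k. i \<in> I \<Longrightarrow> \<bar>f i k\<bar> \<le> C i"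
  shows "\<exists>r l. strict_mono r \<and> (\<forall>i\<in>I. (\<lambda>k. f i (r k)) \<longlonglongrightarrow> l i)"
  using assms
proof (induction I)
  case empty
  show ?case using strict_mono_id by auto
next
  case (insert i I)
  then obtain r l where r: "strict_mono r" "\<And>j. j \<in> I \<Longrightarrow> (\<lambda>k. f j (r k)) \<longlonglongrightarrow> l j"
    by (metis insertCI)
  have "bounded (range (\<lambda>k. f i (r k)))"
    unfolding bounded_iff using insert.prems[of i] by auto
  then obtain m q where q: "strict_mono q" "(\<lambda>k. f i (r (q k))) \<longlonglongrightarrow> m"
    using bounded_imp_convergent_subsequence by (fastforce simp: o_def)
  have "(\<lambda>k. f j (r (q k))) \<longlonglongrightarrow> l j" if "j \<in> I" for j
    using LIMSEQ_subseq_LIMSEQ[OF r(2)[OF that] q(1)] by (simp add: o_def)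
  then show ?case
    using q strict_mono_o[OF r(1) q(1)] insert.hyps
    by (intro exI[of _ "r \<circ> q"] exI[of _ "l(i := m)"]) (auto simp: o_def)
qed

section \<open>Zero risk forces the residual to vanish at every sample\<close>

text \<open>The normal density is positive everywhere, so a null set is Lebesgue null and cannot
  contain a ball.\<close>

lemma emeasure_stdn_open_pos:
  assumes "open X" "x \<in> X"
  shows "emeasure stdn X \<noteq> 0"
proof
  assume 0: "emeasure stdn X = 0"
  have X: "X \<in> sets borel" using assms by auto
  then have "(\<integral>\<^sup>+y. ennreal (std_normal_density y) * indicator X y \<partial>lborel) = 0"
    using 0 by (simp add: emeasure_density)
  then have "AE y in lborel. ennreal (std_normal_density y) * indicator X y = 0"
    using X by (subst (asm) nn_integral_0_iff_AE) auto
  then have "AE y in lborel. y \<notin> X"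
    by eventually_elim (auto simp: indicator_def std_normal_density_def split: if_splits)
  then have "emeasure lborel X = 0"
    using emeasure_eq_0_AE[of "\<lambda>y. y \<in> X" lborel] by simp
  moreover obtain e where e: "e > 0" "ball x e \<subseteq> X" using assms open_contains_ball by blast
  moreover have "emeasure lborel (ball x e) \<le> emeasure lborel X"
    using e X by (intro emeasure_mono) auto
  moreover have "emeasure lborel (ball x e) = ennreal (2 * e)"
    using e by (simp add: ball_eq_greaterThanLessThan)
  ultimately show False by simp
qed

text \<open>A nonzero value persists on an open box around the point, and the box has positive
  measure as a finite product of positive factors.\<close>

lemma continuous_zero_of_nn_integral_zero:
  fixes f :: "('i \<Rightarrow> real) \<Rightarrow> real"
  assumes I: "finite I" and cont: "continuous_on UNIV f"
    and dep: "\<And>\<omega> \<omega>'. (\<And>i. i \<in> I \<Longrightarrow> \<omega> i = \<omega>' i) \<Longrightarrow> f \<omega> = f \<omega>'"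
    and meas: "f \<in> borel_measurable (PiM I (\<lambda>_. stdn))"
    and zero: "(\<integral>\<^sup>+\<omega>. ennreal ((f \<omega>)\<^sup>2) \<partial>PiM I (\<lambda>_. stdn)) = 0"
  shows "f \<omega>0 = 0"
proof (rule ccontr)
  interpret product_sigma_finite "\<lambda>_::'i. stdn" by (rule product_sigma_finite_stdn)
  assume "f \<omega>0 \<noteq> 0"
  define U where "U = {\<omega>. f \<omega> \<noteq> 0}"
  have "open U" unfolding U_def using cont by (intro open_Collect_neq continuous_on_const)
  then have "openin (product_topology (\<lambda>i. euclidean) UNIV) U" by (simp add: open_fun_def)
  moreover have "\<omega>0 \<in> U" using \<open>f \<omega>0 \<noteq> 0\<close> by (simp add: U_def)
  ultimately obtain X where X: "\<omega>0 \<in> (\<Pi>\<^sub>E i\<in>UNIV. X i)" "\<And>i. open (X i)" "(\<Pi>\<^sub>E i\<in>UNIV. X i) \<subseteq> U"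
    using product_topology_open_contains_basis[of "\<lambda>i. euclidean" UNIV U \<omega>0] by auto
  \<comment> \<open>Points of \<open>Pi\<^sub>E I X\<close> are undefined outside \<open>I\<close>.
    They are completed there by \<open>\<omega>0\<close> to land in the open box, which by
    \<open>dep\<close> does not change \<open>f\<close>.\<close>
  have nz: "f \<omega> \<noteq> 0" if "\<omega> \<in> Pi\<^sub>E I X" for \<omega>
  proof -
    have "(\<lambda>i. if i \<in> I then \<omega> i else \<omega>0 i) \<in> (\<Pi>\<^sub>E i\<in>UNIV. X i)"
      using that X(1) by (auto simp: PiE_iff)
    then have "f (\<lambda>i. if i \<in> I then \<omega> i else \<omega>0 i) \<noteq> 0" using X(3) by (auto simp: U_def)
    then show ?thesis using dep[of \<omega> "\<lambda>i. if i \<in> I then \<omega> i else \<omega>0 i"] by auto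
  qed
  have "AE \<omega> in PiM I (\<lambda>_. stdn). ennreal ((f \<omega>)\<^sup>2) = 0"
    using zero meas by (subst (asm) nn_integral_0_iff_AE) auto
  then have "AE \<omega> in PiM I (\<lambda>_. stdn). \<omega> \<notin> Pi\<^sub>E I X"
    by eventually_elim (use nz in auto)
  then have "emeasure (PiM I (\<lambda>_. stdn)) {\<omega> \<in> space (PiM I (\<lambda>_. stdn)). \<omega> \<in> Pi\<^sub>E I X} = 0"
    by (rule emeasure_eq_0_AE)
  moreover have "{\<omega> \<in> space (PiM I (\<lambda>_. stdn)). \<omega> \<in> Pi\<^sub>E I X} = Pi\<^sub>E I X"
    by (auto simp: space_PiM)
  moreover have "emeasure (PiM I (\<lambda>_. stdn)) (Pi\<^sub>E I X) = (\<Prod>i\<in>I. emeasure stdn (X i))"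
    using X(2) I by (intro emeasure_PiM) auto
  moreover have "emeasure stdn (X i) \<noteq> 0" for i
    using X(1,2) by (intro emeasure_stdn_open_pos[of _ "\<omega>0 i"]) auto
  ultimately show False using I by (simp add: prod_zero_iff)
qed

lemma resid_cong:
  assumes "\<And>c j. c < n + 2 \<Longrightarrow> j < d \<Longrightarrow> \<omega> (c, j) = \<omega>' (c, j)"
  shows "resid d n \<alpha> A \<beta> B \<omega> = resid d n \<alpha> A \<beta> B \<omega>'"
proof -
  have "dotp d (\<lambda>j. \<omega> (c, j)) (\<lambda>j. \<omega> (e, j)) = dotp d (\<lambda>j. \<omega>' (c, j)) (\<lambda>j. \<omega>' (e, j))"
    "bform d M (\<lambda>j. \<omega> (c, j)) (\<lambda>j. \<omega> (e, j)) = bform d M (\<lambda>j. \<omega>' (c, j)) (\<lambda>j. \<omega>' (e, j))"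
    if "c < n + 2" "e < n + 2" for c e M
    using assms that by (auto intro!: dotp_cong bform_cong)
  then show ?thesis unfolding resid_def Let_def
    by (intro arg_cong2[where f="(+)"] arg_cong2[where f="(*)"] refl sum.cong) auto
qed

lemma resid_continuous: "continuous_on UNIV (resid d n \<alpha> A \<beta> B)"
  unfolding resid_def Let_def bform_def dotp_def
  by (intro continuous_intros continuous_on_product_coordinates)

lemma resid_eq_0_of_risk_eq_0:
  assumes "risk d n \<alpha> A \<beta> B = 0"
  shows "resid d n \<alpha> A \<beta> B \<omega> = 0"
proof (rule continuous_zero_of_nn_integral_zero[where f="resid d n \<alpha> A \<beta> B" and I="{0..n+1} \<times> {0..<d}"])
  show "finite ({0..n+1} \<times> {0..<d})" by simp
  show "continuous_on UNIV (resid d n \<alpha> A \<beta> B)" by (rule resid_continuous)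
  show "resid d n \<alpha> A \<beta> B \<in> borel_measurable (PiM ({0..n+1} \<times> {0..<d}) (\<lambda>_. stdn))"
    using resid_measurable unfolding gauss_space_def .
  show "(\<integral>\<^sup>+\<omega>. ennreal ((resid d n \<alpha> A \<beta> B \<omega>)\<^sup>2) \<partial>PiM ({0..n+1} \<times> {0..<d}) (\<lambda>_. stdn)) = 0"
    using assms unfolding risk_def gauss_space_def .
  show "resid d n \<alpha> A \<beta> B \<eta> = resid d n \<alpha> A \<beta> B \<eta>'"
    if "\<And>i. i \<in> {0..n+1} \<times> {0..<d} \<Longrightarrow> \<eta> i = \<eta>' i" for \<eta> \<eta>'
    by (rule resid_cong, rule that) auto
qed

section \<open>Existence of a minimizer among diagonal pairs\<close>

definition diagf :: "(nat \<Rightarrow> real) \<Rightarrow> nat \<Rightarrow> nat \<Rightarrow> real" where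
  "diagf u i j = (if i = j then u i else 0)"

lemma bform_diagf: "bform d (diagf u) x y = (\<Sum>i<d. u i * x i * y i)"
proof -
  have "dotp d (diagf u i) y = u i * y i" if "i < d" for i
  proof -
    have "dotp d (diagf u i) y = (\<Sum>j<d. if j = i then u i * y i else 0)"
      unfolding dotp_def diagf_def by (intro sum.cong) auto
    then show ?thesis using that by simp
  qed
  then show ?thesis by (simp add: bform_def dotp_def mult_ac)
qed

text \<open>At a sample whose training inputs all equal \<open>z\<close>, the averages collapse to
  single terms and \<open>n\<close> disappears, leaving a simple polynomial for testing.\<close>

lemma resid_repeated_column:
  assumes "n \<ge> 1"
  shows "resid d n \<alpha> A \<beta> B (\<lambda>(c, j). if c < n then z j else if c = n then x j else w j)
    = \<alpha> * \<beta> * dotp d w x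
      + dotp d w z * (\<beta> * bform d A z x + \<alpha> * bform d B z x + bform d A z z * bform d B z x)"
  using assms by (simp add: resid_def Let_def field_simps power2_eq_square)

text \<open>The residual vanishes identically, so its value at scaled unit vectors, and at one sum
  of two unit vectors, gives enough equations on the coefficients.\<close>

lemma risk_diagf_eq_0:
  assumes n: "n \<ge> 1" and d: "d \<ge> 1" and zero: "risk d n \<alpha> (diagf u) \<beta> (diagf v) = 0"
  shows "(\<alpha> = 0 \<and> (\<forall>i<d. u i = 0)) \<or> (\<beta> = 0 \<and> (\<forall>i<d. v i = 0))"
proof (rule ccontr)
  let ?U = "bform d (diagf u)" and ?V = "bform d (diagf v)"
  assume "\<not> ?thesis"
  then have u: "\<alpha> \<noteq> 0 \<or> (\<exists>i<d. u i \<noteq> 0)" and v: "\<beta> \<noteq> 0 \<or> (\<exists>j<d. v j \<noteq> 0)" by auto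
  have R: "\<alpha> * \<beta> * dotp d w x + dotp d w z * (\<beta> * ?U z x + \<alpha> * ?V z x + ?U z z * ?V z x) = 0" for z x w
    using resid_eq_0_of_risk_eq_0[OF zero] unfolding resid_repeated_column[OF n, symmetric] .
  define e :: "real \<Rightarrow> nat \<Rightarrow> nat \<Rightarrow> real" where "e = (\<lambda>s i j. if j = i then s else 0)"
  have dotp_e: "dotp d (e s i) y = s * y i" if "i < d" for s i y
  proof -
    have "dotp d (e s i) y = (\<Sum>j<d. if j = i then s * y i else 0)"
      unfolding dotp_def e_def by (intro sum.cong) auto
    then show ?thesis using that by simp
  qed
  have bform_e: "bform d (diagf f) y (e s i) = s * (f i * y i)" if "i < d" for s i y f
    unfolding bform_diagf using dotp_e[OF that, of s "\<lambda>i. f i * y i"] by (simp add: dotp_def mult_ac)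
  \<comment> \<open>Taking \<open>w\<close> and \<open>x\<close> as the unit vector \<open>i\<close>
    and \<open>z\<close> as its multiple by \<open>s\<close> gives a polynomial in \<open>s\<close>;
    the values at 0, 1 and 2 isolate its three coefficients.\<close>
  have diag: "\<alpha> * \<beta> + s\<^sup>2 * (\<beta> * u i + \<alpha> * v i + s\<^sup>2 * (u i * v i)) = 0" if i: "i < d" for s i
  proof -
    have "\<alpha> * \<beta> * 1 + s * (\<beta> * (u i * s) + \<alpha> * (v i * s) + (s * (u i * s)) * (v i * s)) = 0"
      using R[of "e 1 i" "e 1 i" "e s i"] by (simp add: dotp_e[OF i] bform_e[OF i]) (simp add: e_def)
    then show ?thesis by (simp add: power2_eq_square algebra_simps)
  qed
  have "\<alpha> * \<beta> = 0" using diag[of 0 0] d by simp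
  have c1: "\<beta> * u i + \<alpha> * v i = 0" and c2: "u i * v i = 0" if i: "i < d" for i
  proof -
    have "\<beta> * u i + \<alpha> * v i + u i * v i = 0" "4 * (\<beta> * u i + \<alpha> * v i + 4 * (u i * v i)) = 0"
      using diag[OF i, of 1] diag[OF i, of 2] \<open>\<alpha> * \<beta> = 0\<close> by simp_all
    moreover have "X = 0 \<and> Y = 0" if XY: "X + Y = 0" "4 * (X + 4 * Y) = 0" for X Y :: real
    proof -
      have "X = - Y" using XY(1) by (simp add: eq_neg_iff_add_eq_0)
      then show ?thesis using XY(2) by simp
    qed
    ultimately show "\<beta> * u i + \<alpha> * v i = 0" "u i * v i = 0" by blast+
  qed
  show False
  proof (cases "\<alpha> = 0 \<and> \<beta> = 0")
    case False
    then show ?thesis using c1 u v \<open>\<alpha> * \<beta> = 0\<close> by force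
  next
    case True
    then obtain i j where ij: "i < d" "j < d" "u i \<noteq> 0" "v j \<noteq> 0" using u v by auto
    then have z: "v i = 0" "u j = 0" "i \<noteq> j" using c2[of i] c2[of j] by auto
    \<comment> \<open>With both scalars zero only the mixed term is left. For \<open>z\<close> the
      sum of unit vectors \<open>i\<close> and \<open>j\<close>, \<open>w\<close> the first and
      \<open>x\<close> the second, it equals \<open>u i * v j\<close>, which is nonzero.\<close>
    define z where "z = (\<lambda>k. if k = i \<or> k = j then 1 else 0 :: real)"
    have "?U z z = dotp d (e (u i) i) (\<lambda>_. 1)"
      unfolding bform_diagf dotp_def by (intro sum.cong) (auto simp: z_def e_def z)
    then have "?U z z = u i" using ij by (simp add: dotp_e)
    moreover have "?V z (e 1 j) = v j" "dotp d (e 1 i) z = 1"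
      using ij by (simp_all add: bform_e dotp_e z_def)
    ultimately show ?thesis using R[of "e 1 i" "e 1 j" z] True ij by simp
  qed
qed

lemma risk_diagf_minimizer:
  assumes n: "n \<ge> 1" and d: "d \<ge> 1"
  shows "\<exists>a b. \<forall>a' b'. risk d n 1 (diagf a) 1 (diagf b) \<le> risk d n 1 (diagf a') 1 (diagf b')"
proof -
  define V where "V = (\<lambda>(a, b). risk d n 1 (diagf a) 1 (diagf b))"
  define L where "L = Inf (range V)"
  show ?thesis
  proof (cases "L = \<infinity>")
    \<comment> \<open>If the infimum is infinite, every pair is a minimizer, so finiteness of the
      risk never has to be proved.\<close>
    case True
    have "V z = \<infinity>" for z
    proof -
      have "L \<le> V z" unfolding L_def by (rule Inf_lower) simp
      then show ?thesis using True by (simp add: top_unique)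
    qed
    then show ?thesis by (auto simp: V_def)
  next
    case False
    obtain F where F: "decseq F" "range F \<subseteq> range V" "L = (INF k. F k)"
      using ennreal_Inf_countable_INF[of "range V"] by (auto simp: L_def)
    then have "\<exists>a b. F k = V (a, b)" for k by (metis rangeI subsetD surj_pair rangeE)
    then obtain a b where ab: "\<And>k. F k = V (a k, b k)" by metis
    have lim: "F \<longlonglongrightarrow> L" unfolding F(3) using F(1) by (rule LIMSEQ_INF)
    \<comment> \<open>The factors \<open>s k\<close> and \<open>t k\<close> scale
      \<open>(1, a k)\<close> and \<open>(1, b k)\<close> to unit l1 norm, so a subsequence
      converges even if the original sequences are unbounded.\<close>
    define s where "s = (\<lambda>k. 1 / (1 + (\<Sum>i<d. \<bar>a k i\<bar>)))"
    define t where "t = (\<lambda>k. 1 / (1 + (\<Sum>i<d. \<bar>b k i\<bar>)))"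
    have norm1: "\<bar>1 / (1 + (\<Sum>i<d. \<bar>g i\<bar>))\<bar> + (\<Sum>i<d. \<bar>1 / (1 + (\<Sum>i<d. \<bar>g i\<bar>)) * g i\<bar>) = 1" for g :: "nat \<Rightarrow> real"
    proof -
      have "0 \<le> (\<Sum>i<d. \<bar>g i\<bar>)" by (simp add: sum_nonneg)
      then have "1 + (\<Sum>i<d. \<bar>g i\<bar>) > 0" by linarith
      then show ?thesis
        by (simp add: abs_mult sum_divide_distrib[symmetric] add_divide_distrib[symmetric])
    qed
    have s1: "\<bar>s k\<bar> + (\<Sum>i<d. \<bar>s k * a k i\<bar>) = 1" and t1: "\<bar>t k\<bar> + (\<Sum>i<d. \<bar>t k * b k i\<bar>) = 1" for k
      unfolding s_def t_def by (rule norm1)+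
    \<comment> \<open>The tag \<open>h\<close> packs four kinds of sequences into one family, so a
      single extraction serves all. The scalars are later read at index 0, which exists because
      \<open>d \<ge> 1\<close>.\<close>
    define f where "f = (\<lambda>(h::nat, i) k. if h = 0 then s k else if h = 1 then t k
        else if h = 2 then s k * a k i else t k * b k i)"
    have le: "\<bar>x k * g k i\<bar> \<le> 1" if "\<And>k. \<bar>x k\<bar> + (\<Sum>i<d. \<bar>x k * g k i\<bar>) = 1" "i < d" for x :: "nat \<Rightarrow> real" and g k i
      using that(1)[of k] member_le_sum[of i "{..<d}" "\<lambda>i. \<bar>x k * g k i\<bar>"] that(2) by auto
    have le0: "\<bar>x k\<bar> \<le> 1" if "\<And>k. \<bar>x k\<bar> + (\<Sum>i<d. \<bar>x k * g k i\<bar>) = 1" for x :: "nat \<Rightarrow> real" and g k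
    proof -
      have "0 \<le> (\<Sum>i<d. \<bar>x k * g k i\<bar>)" by (intro sum_nonneg) simp
      then show ?thesis using that[of k] by linarith
    qed
    have bd: "\<bar>f p k\<bar> \<le> 1" if "p \<in> {..<4} \<times> {..<d}" for p k
    proof -
      obtain h i where p: "p = (h, i)" "i < d" using \<open>p \<in> _\<close> by (cases p) auto
      show ?thesis
        using le[of s a, OF s1 p(2), of k] le[of t b, OF t1 p(2), of k] le0[of s a, OF s1, of k] le0[of t b, OF t1, of k]
        by (simp add: f_def p(1))
    qed
    have "finite ({..<4::nat} \<times> {..<d})" by simp
    from bounded_seqs_common_subseq[of _ f "\<lambda>_. 1", OF this bd] obtain r l where r: "strict_mono r"
      and "\<forall>p \<in> {..<4} \<times> {..<d}. (\<lambda>k. f p (r k)) \<longlonglongrightarrow> l p"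
      by blast
    note l = bspec[OF this(2)]
    define \<sigma> \<tau> u v where "\<sigma> = l (0, 0)" "\<tau> = l (1, 0)" "u = (\<lambda>i. l (2, i))" "v = (\<lambda>i. l (3, i))"
    have lims: "(\<lambda>k. s (r k)) \<longlonglongrightarrow> \<sigma>" "(\<lambda>k. t (r k)) \<longlonglongrightarrow> \<tau>"
      using l[of "(0, 0)"] l[of "(1, 0)"] d by (simp_all add: f_def \<sigma>_\<tau>_u_v_def)
    have limv: "(\<lambda>k. s (r k) * a (r k) i) \<longlonglongrightarrow> u i" "(\<lambda>k. t (r k) * b (r k) i) \<longlonglongrightarrow> v i" if "i < d" for i
      using l[of "(2, i)"] l[of "(3, i)"] that by (simp_all add: f_def \<sigma>_\<tau>_u_v_def)
    have "(\<lambda>k. \<bar>s (r k)\<bar> + (\<Sum>i<d. \<bar>s (r k) * a (r k) i\<bar>)) \<longlonglongrightarrow> \<bar>\<sigma>\<bar> + (\<Sum>i<d. \<bar>u i\<bar>)"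
      "(\<lambda>k. \<bar>t (r k)\<bar> + (\<Sum>i<d. \<bar>t (r k) * b (r k) i\<bar>)) \<longlonglongrightarrow> \<bar>\<tau>\<bar> + (\<Sum>i<d. \<bar>v i\<bar>)"
      by (intro tendsto_intros lims limv; simp)+
    then have unit: "\<bar>\<sigma>\<bar> + (\<Sum>i<d. \<bar>u i\<bar>) = 1" "\<bar>\<tau>\<bar> + (\<Sum>i<d. \<bar>v i\<bar>) = 1"
      unfolding s1 t1 by (simp_all add: LIMSEQ_const_iff)
    have scale: "risk d n x (diagf (\<lambda>i. x * g i)) y (diagf (\<lambda>i. y * h i)) = ennreal (x\<^sup>2 * y\<^sup>2) * V (g, h)" for x y g h
    proof -
      have "diagf (\<lambda>i. z * k i) = (\<lambda>i j. z * diagf k i j)" for z k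
        by (auto simp: diagf_def fun_eq_iff)
      then show ?thesis using risk_scale[of d n x 1 "diagf g" y 1 "diagf h"] by (simp add: V_def)
    qed
    have "risk d n \<sigma> (diagf u) \<tau> (diagf v)
       \<le> liminf (\<lambda>k. risk d n (s (r k)) (diagf (\<lambda>i. s (r k) * a (r k) i)) (t (r k)) (diagf (\<lambda>i. t (r k) * b (r k) i)))"
      by (intro risk_liminf lims) (auto simp: diagf_def limv)
    also have "\<dots> = liminf (\<lambda>k. ennreal ((s (r k))\<^sup>2 * (t (r k))\<^sup>2) * F (r k))"
      unfolding scale ab ..
    also have "\<dots> = ennreal (\<sigma>\<^sup>2 * \<tau>\<^sup>2) * L"
    \<comment> \<open>Products of limits are safe here: \<open>L\<close> is finite, so no product of
      zero and infinity occurs.\<close>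
    proof (rule lim_imp_Liminf[OF sequentially_bot], rule tendsto_mult_ennreal)
      show "(\<lambda>k. F (r k)) \<longlonglongrightarrow> L" using LIMSEQ_subseq_LIMSEQ[OF lim r] by (simp add: o_def)
      show "(\<lambda>k. ennreal ((s (r k))\<^sup>2 * (t (r k))\<^sup>2)) \<longlonglongrightarrow> ennreal (\<sigma>\<^sup>2 * \<tau>\<^sup>2)"
        by (intro tendsto_intros lims)
    qed (use False in auto)
    finally have le: "risk d n \<sigma> (diagf u) \<tau> (diagf v) \<le> ennreal (\<sigma>\<^sup>2 * \<tau>\<^sup>2) * L" .
    \<comment> \<open>If either scalar limit were zero, the bound \<open>le\<close> would give zero
      risk, whereas both limit pairs still have unit norm and hence are nonzero.\<close>
    have nz: "\<sigma> \<noteq> 0" "\<tau> \<noteq> 0"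
    proof -
      have "risk d n \<sigma> (diagf u) \<tau> (diagf v) \<noteq> 0"
        using risk_diagf_eq_0[OF n d, of \<sigma> u \<tau> v] unit by auto
      then show "\<sigma> \<noteq> 0" "\<tau> \<noteq> 0" using le by auto
    qed
    have "risk d n \<sigma> (diagf u) \<tau> (diagf v) = ennreal (\<sigma>\<^sup>2 * \<tau>\<^sup>2) * V (\<lambda>i. u i / \<sigma>, \<lambda>i. v i / \<tau>)"
      using scale[of \<sigma> "\<lambda>i. u i / \<sigma>" \<tau> "\<lambda>i. v i / \<tau>"] nz by simp
    then have "V (\<lambda>i. u i / \<sigma>, \<lambda>i. v i / \<tau>) \<le> L"
      using le nz by (simp add: ennreal_mult_le_mult_iff)
    then have "V (\<lambda>i. u i / \<sigma>, \<lambda>i. v i / \<tau>) \<le> V z" for z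
      using Inf_lower[of "V z" "range V"] unfolding L_def by (auto intro: order_trans)
    then have "\<forall>a' b'. V (\<lambda>i. u i / \<sigma>, \<lambda>i. v i / \<tau>) \<le> V (a', b')" by blast
    then show ?thesis unfolding V_def prod.case by blast
  qed
qed

section \<open>Making the first matrix diagonal by maximising a weighted trace\<close>

definition symf :: "nat \<Rightarrow> (nat \<Rightarrow> nat \<Rightarrow> real) \<Rightarrow> bool" where
  "symf d A \<longleftrightarrow> (\<forall>i<d. \<forall>j<d. A i j = A j i)"

text \<open>Unlike a bound on the entries, this bound is invariant under reflections.\<close>

definition boundedf :: "nat \<Rightarrow> real \<Rightarrow> (nat \<Rightarrow> nat \<Rightarrow> real) \<Rightarrow> bool" where
  "boundedf d C A \<longleftrightarrow> (\<forall>x y. (bform d A x y)\<^sup>2 \<le> C * (dotp d x x * dotp d y y))"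

lemma dotp_unit: "i < d \<Longrightarrow> dotp d (\<lambda>k. if k = i then 1 else 0) y = y i"
proof -
  assume "i < d"
  moreover have "dotp d (\<lambda>k. if k = i then 1 else 0) y = (\<Sum>k<d. if k = i then y i else 0)"
    unfolding dotp_def by (intro sum.cong) auto
  ultimately show ?thesis by simp
qed

lemma bform_unit:
  "i < d \<Longrightarrow> j < d \<Longrightarrow> bform d A (\<lambda>k. if k = i then 1 else 0) (\<lambda>k. if k = j then 1 else 0) = A i j"
  by (simp add: bform_def dotp_unit dotp_commute[of d "A _"])

text \<open>This coordinate-free form of symmetry passes to conjugates under reflections at once,
  and to limits as well.\<close>

lemma symf_iff_bform: "symf d A \<longleftrightarrow> (\<forall>x y. bform d A x y = bform d A y x)"
proof
  assume A: "symf d A"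
  show "\<forall>x y. bform d A x y = bform d A y x"
  proof (intro allI)
    fix x y
    have "bform d A x y = (\<Sum>i<d. \<Sum>j<d. y j * A j i * x i)"
      unfolding bform_sum using A by (intro sum.cong) (auto simp: symf_def)
    also have "\<dots> = bform d A y x" unfolding bform_sum by (rule sum.swap)
    finally show "bform d A x y = bform d A y x" .
  qed
next
  assume "\<forall>x y. bform d A x y = bform d A y x"
  then show "symf d A" unfolding symf_def by (metis bform_unit)
qed

lemma symf_conj2: "p < d \<Longrightarrow> q < d \<Longrightarrow> p \<noteq> q \<Longrightarrow> symf d A \<Longrightarrow> symf d (conj2 p q a b A)"
  by (simp add: symf_iff_bform bform_conj2)

lemma boundedf_conj2:
  "p < d \<Longrightarrow> q < d \<Longrightarrow> p \<noteq> q \<Longrightarrow> a\<^sup>2 + b\<^sup>2 = 1 \<Longrightarrow> boundedf d C A \<Longrightarrow> boundedf d C (conj2 p q a b A)"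
  unfolding boundedf_def by (metis bform_conj2 dotp_refl2_refl2)

lemma boundedf_entry:
  assumes "boundedf d C A" "i < d" "j < d"
  shows "\<bar>A i j\<bar> \<le> 1 + C"
proof -
  have "(A i j)\<^sup>2 \<le> C"
    using assms(1)[unfolded boundedf_def, rule_format, of "\<lambda>k. if k = i then 1 else 0" "\<lambda>k. if k = j then 1 else 0"]
    by (simp add: bform_unit dotp_unit assms)
  moreover have "\<bar>A i j\<bar> \<le> 1 + (A i j)\<^sup>2"
    using zero_le_power2[of "\<bar>A i j\<bar> - 1"] zero_le_power2[of "A i j"] by (simp add: power2_diff)
  ultimately show ?thesis by linarith
qed

text \<open>Each coordinate is at most the Euclidean norm, so the square of the sum of absolute
  entries is a valid constant.\<close>

lemma boundedf_exists: "\<exists>C. boundedf d C A"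
proof -
  define M where "M = (\<Sum>i<d. \<Sum>j<d. \<bar>A i j\<bar>)"
  have "(bform d A x y)\<^sup>2 \<le> M\<^sup>2 * (dotp d x x * dotp d y y)" for x y
  proof -
    have le: "\<bar>z i\<bar> \<le> sqrt (dotp d z z)" if "i < d" for z i
      using member_le_sum[of i "{..<d}" "\<lambda>i. z i * z i"] that
      by (intro real_le_rsqrt) (auto simp: dotp_def power2_eq_square)
    have nn: "0 \<le> dotp d z z" for z by (simp add: dotp_def sum_nonneg)
    have "\<bar>bform d A x y\<bar> \<le> (\<Sum>i<d. \<Sum>j<d. \<bar>x i\<bar> * \<bar>A i j\<bar> * \<bar>y j\<bar>)"
      unfolding bform_sum
      by (intro order_trans[OF sum_abs] sum_mono) (auto intro!: order_trans[OF sum_abs] sum_mono simp: abs_mult)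
    also have "\<dots> \<le> (\<Sum>i<d. \<Sum>j<d. sqrt (dotp d x x) * \<bar>A i j\<bar> * sqrt (dotp d y y))"
      by (intro sum_mono mult_mono le) (auto simp: nn)
    also have "\<dots> = M * (sqrt (dotp d x x) * sqrt (dotp d y y))"
      by (simp add: M_def sum_distrib_right sum_distrib_left mult_ac)
    finally have "\<bar>bform d A x y\<bar> \<le> \<dots>" .
    then have "\<bar>bform d A x y\<bar>\<^sup>2 \<le> (M * (sqrt (dotp d x x) * sqrt (dotp d y y)))\<^sup>2"
      by (intro power_mono) auto
    then show ?thesis using nn by (simp add: power_mult_distrib)
  qed
  then show ?thesis unfolding boundedf_def by blast
qed

text \<open>The reflection with parameter \<open>t\<close> (rational parametrisation of the circle) changes \<open>A q q\<close> by
  \<open>b\<^sup>2 \<delta> - 2 a b \<alpha>\<close>, whose dominant term for small \<open>t\<close> is \<open>- 4 t \<alpha>\<close>.\<close>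

lemma weighted_trace_increase:
  assumes pq: "p < q" "q < d" and sym: "A p q = A q p" and nz: "A p q \<noteq> 0"
  shows "\<exists>a b. a\<^sup>2 + b\<^sup>2 = 1 \<and> a \<noteq> 0 \<and> (\<Sum>i<d. real i * A i i) < (\<Sum>i<d. real i * conj2 p q a b A i i)"
proof -
  define \<alpha> where "\<alpha> = A p q"
  define \<delta> where "\<delta> = A p p - A q q"
  \<comment> \<open>This size gives \<open>\<epsilon> * \<bar>\<delta>\<bar> \<le>
    \<bar>\<alpha>\<bar> / 2\<close> and \<open>\<epsilon> \<le> 1 / 2\<close>, so the linear term
    beats the quadratic one; \<open>t\<close> takes the sign opposite to \<open>\<alpha>\<close> to
    make the linear term positive.\<close>
  define \<epsilon> where "\<epsilon> = \<bar>\<alpha>\<bar> / (2 * (\<bar>\<alpha>\<bar> + \<bar>\<delta>\<bar>))"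
  define t where "t = - sgn \<alpha> * \<epsilon>"
  define a where "a = (1 - t\<^sup>2) / (1 + t\<^sup>2)"
  define b where "b = 2 * t / (1 + t\<^sup>2)"
  have \<alpha>: "\<bar>\<alpha>\<bar> > 0" using nz by (simp add: \<alpha>_def)
  have \<epsilon>: "0 < \<epsilon>" "\<epsilon> \<le> 1 / 2" using \<alpha> by (auto simp: \<epsilon>_def field_simps)
  have t2: "t\<^sup>2 = \<epsilon>\<^sup>2" using \<alpha> by (simp add: t_def power_mult_distrib sgn_if)
  have "\<epsilon>\<^sup>2 \<le> (1 / 2)\<^sup>2" using \<epsilon> by (intro power_mono) auto
  then have e2: "t\<^sup>2 \<le> 1 / 4" unfolding t2 by (simp add: power2_eq_square)
  have pos: "1 + t\<^sup>2 > 0" by (simp add: add_pos_nonneg)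
  have "(1 - t\<^sup>2)\<^sup>2 + (2 * t)\<^sup>2 = (1 + t\<^sup>2)\<^sup>2" by (simp add: power2_eq_square algebra_simps)
  then have ab: "a\<^sup>2 + b\<^sup>2 = 1"
    using pos by (simp add: a_def b_def power_divide add_divide_distrib[symmetric])
  have "a \<noteq> 0" using e2 pos by (simp add: a_def)
  have inner: "0 < b\<^sup>2 * \<delta> - 2 * a * b * \<alpha>"
  proof -
    have "\<epsilon> * \<bar>\<delta>\<bar> \<le> \<bar>\<alpha>\<bar> / 2"
    proof -
      have "\<epsilon> * \<bar>\<delta>\<bar> \<le> \<epsilon> * (\<bar>\<alpha>\<bar> + \<bar>\<delta>\<bar>)" using \<epsilon> by (intro mult_left_mono) auto
      also have "\<dots> = \<bar>\<alpha>\<bar> / 2"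
      proof -
        have "\<bar>\<alpha>\<bar> + \<bar>\<delta>\<bar> \<noteq> 0" using \<alpha> by simp
        moreover have "x / (2 * y) * y = x / 2" if "y \<noteq> 0" for x y :: real using that by simp
        ultimately show ?thesis unfolding \<epsilon>_def by blast
      qed
      finally show ?thesis .
    qed
    moreover have "\<bar>\<alpha>\<bar> * (3 / 4) \<le> \<bar>\<alpha>\<bar> * (1 - t\<^sup>2)" using e2 by (intro mult_left_mono) auto
    moreover have "\<epsilon> * \<delta> \<ge> - (\<epsilon> * \<bar>\<delta>\<bar>)" using \<epsilon> by (simp add: abs_if)
    ultimately have "0 < \<epsilon> * \<delta> + \<bar>\<alpha>\<bar> * (1 - t\<^sup>2)" using \<alpha> by linarith
    then have "0 < 4 * \<epsilon> * (\<epsilon> * \<delta> + \<bar>\<alpha>\<bar> * (1 - t\<^sup>2))" using \<epsilon> by simp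
    also have "\<dots> = 4 * t\<^sup>2 * \<delta> - 4 * t * (1 - t\<^sup>2) * \<alpha>"
    proof -
      have gen: "4 * x * (x * y + z * w) = 4 * x\<^sup>2 * y + 4 * (x * z) * w" for x y z w :: real
        by (simp add: power2_eq_square algebra_simps)
      have "\<epsilon> * \<bar>\<alpha>\<bar> = - t * \<alpha>" by (simp add: t_def abs_sgn mult_ac)
      then show ?thesis unfolding gen t2 by simp
    qed
    also have "\<dots> = (1 + t\<^sup>2)\<^sup>2 * (b\<^sup>2 * \<delta> - 2 * a * b * \<alpha>)"
    proof -
      have "b * (1 + t\<^sup>2) = 2 * t" "a * (1 + t\<^sup>2) = 1 - t\<^sup>2" using pos by (simp_all add: a_def b_def)
      moreover have gen: "r\<^sup>2 * (b\<^sup>2 * \<delta> - 2 * a * b * \<alpha>) = (b * r)\<^sup>2 * \<delta> - 2 * (a * r) * (b * r) * \<alpha>" for r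
        by (simp add: power2_eq_square algebra_simps)
      ultimately show ?thesis unfolding gen by (simp add: power_mult_distrib)
    qed
    finally show ?thesis by (simp add: zero_less_mult_iff)
  qed
  let ?B = "conj2 p q a b A"
  have split: "(\<Sum>i<d. real i * M i i) = real p * M p p + (real q * M q q + (\<Sum>i\<in>{..<d} - {p} - {q}. real i * M i i))" for M :: "nat \<Rightarrow> nat \<Rightarrow> real"
    using pq by (subst sum.remove[of _ p], simp, simp, subst sum.remove[of _ q]) auto
  have rest: "(\<Sum>i\<in>{..<d} - {p} - {q}. real i * ?B i i) = (\<Sum>i\<in>{..<d} - {p} - {q}. real i * A i i)"
    by (intro sum.cong) (auto simp: conj2_def refl2_def)
  have Bp: "?B p p = a\<^sup>2 * A p p + 2 * a * b * \<alpha> + b\<^sup>2 * A q q" and Bq: "?B q q = b\<^sup>2 * A p p - 2 * a * b * \<alpha> + a\<^sup>2 * A q q"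
    using pq sym by (simp_all add: conj2_def refl2_def \<alpha>_def power2_eq_square algebra_simps)
  have a2: "a\<^sup>2 = 1 - b\<^sup>2" using ab by simp
  \<comment> \<open>The reflection preserves \<open>A p p + A q q\<close> and moves the amount
    \<open>\<eta>\<close> from position \<open>p\<close> to position \<open>q\<close>, whose weight
    is larger.\<close>
  define \<eta> where "\<eta> = b\<^sup>2 * \<delta> - 2 * a * b * \<alpha>"
  have Bpq: "?B p p = A p p - \<eta>" "?B q q = A q q + \<eta>"
    unfolding Bp Bq a2 \<delta>_def \<eta>_def by (simp_all add: algebra_simps)
  have "(\<Sum>i<d. real i * ?B i i) - (\<Sum>i<d. real i * A i i) = (real q - real p) * \<eta>"
    unfolding split[of A] split[of ?B] rest Bpq by (simp add: algebra_simps)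
  also have "\<dots> > 0" using inner pq by (simp add: \<eta>_def)
  finally show ?thesis using ab \<open>a \<noteq> 0\<close> by auto
qed

text \<open>Distinct weights are essential: the plain trace is invariant under conjugation and would
  not detect off-diagonal entries. The second family is conjugated along with the first and stays
  symmetric.\<close>

lemma risk_diagonalize_first:
  assumes "symf d A" "symf d B"
  shows "\<exists>u B'. symf d B' \<and> risk d n 1 (diagf u) 1 B' \<le> risk d n 1 A 1 B"
proof -
  obtain C1 C2 where C: "boundedf d C1 A" "boundedf d C2 B" using boundedf_exists by metis
  \<comment> \<open>The bounds come from the given pair, which therefore lies in \<open>S\<close>.
    All conditions survive simultaneous reflection and entrywise limits.\<close>
  define S where "S = {(A', B'). symf d A' \<and> symf d B' \<and> boundedf d C1 A' \<and> boundedf d C2 B'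
     \<and> risk d n 1 A' 1 B' \<le> risk d n 1 A 1 B}"
  define tr where "tr = (\<lambda>(A'::nat\<Rightarrow>nat\<Rightarrow>real, B'::nat\<Rightarrow>nat\<Rightarrow>real). \<Sum>i<d. real i * A' i i)"
  have "(A, B) \<in> S" using assms C by (simp add: S_def)
  have bdd: "bdd_above (tr ` S)"
  proof (rule bdd_aboveI)
    fix y assume "y \<in> tr ` S"
    then obtain A' B' where y: "y = (\<Sum>i<d. real i * A' i i)" "boundedf d C1 A'" by (auto simp: S_def tr_def)
    show "y \<le> (\<Sum>i<d. real i * (1 + C1))"
      unfolding y(1) using boundedf_entry[OF y(2)] by (intro sum_mono mult_left_mono) (auto simp: abs_le_iff)
  qed
  define T where "T = Sup (tr ` S)"
  have "\<exists>z\<in>S. T - 1 / real (Suc k) < tr z" for k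
    using less_cSup_iff[OF _ bdd, of "T - 1 / real (Suc k)"] \<open>(A, B) \<in> S\<close> by (auto simp: T_def)
  then obtain z where z: "\<And>k. z k \<in> S" "\<And>k. T - 1 / real (Suc k) < tr (z k)" by metis
  define f where "f = (\<lambda>(h::bool, i, j) k. if h then fst (z k) i j else snd (z k) i j)"
  have zS: "symf d (fst (z k))" "symf d (snd (z k))" "boundedf d C1 (fst (z k))" "boundedf d C2 (snd (z k))"
    "risk d n 1 (fst (z k)) 1 (snd (z k)) \<le> risk d n 1 A 1 B" for k
    using z(1)[of k] by (auto simp: S_def)
  have bd: "\<bar>f p k\<bar> \<le> 1 + max C1 C2" if "p \<in> UNIV \<times> {..<d} \<times> {..<d}" for p k
  proof -
    obtain h i j where p: "p = (h, i, j)" "i < d" "j < d" using \<open>p \<in> _\<close> by auto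
    show ?thesis
      using boundedf_entry[OF zS(3)[of k] p(2,3)] boundedf_entry[OF zS(4)[of k] p(2,3)] by (auto simp: f_def p(1))
  qed
  have "finite ((UNIV :: bool set) \<times> {..<d} \<times> {..<d})" by simp
  from bounded_seqs_common_subseq[of _ f "\<lambda>_. 1 + max C1 C2", OF this bd] obtain r l where r: "strict_mono r"
    and "\<forall>p \<in> UNIV \<times> {..<d} \<times> {..<d}. (\<lambda>k. f p (r k)) \<longlonglongrightarrow> l p"
    by blast
  note l = bspec[OF this(2)]
  define A' where "A' = (\<lambda>i j. l (True, i, j))"
  define B' where "B' = (\<lambda>i j. l (False, i, j))"
  have lA: "(\<lambda>k. fst (z (r k)) i j) \<longlonglongrightarrow> A' i j" and lB: "(\<lambda>k. snd (z (r k)) i j) \<longlonglongrightarrow> B' i j" if "i < d" "j < d" for i j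
    using l[of "(True, i, j)"] l[of "(False, i, j)"] that by (simp_all add: f_def A'_def B'_def)
  have bA: "(\<lambda>k. bform d (fst (z (r k))) x y) \<longlonglongrightarrow> bform d A' x y"
    and bB: "(\<lambda>k. bform d (snd (z (r k))) x y) \<longlonglongrightarrow> bform d B' x y" for x y
    unfolding bform_sum by (intro tendsto_intros lA lB; simp)+
  have "bform d A' x y = bform d A' y x" "bform d B' x y = bform d B' y x" for x y
  proof -
    have "bform d (fst (z k)) y x = bform d (fst (z k)) x y" "bform d (snd (z k)) y x = bform d (snd (z k)) x y" for k
      using zS(1,2)[of k] unfolding symf_iff_bform by blast+
    then show "bform d A' x y = bform d A' y x" "bform d B' x y = bform d B' y x"
      using bA[of y x] bB[of y x] LIMSEQ_unique[OF bA[of x y]] LIMSEQ_unique[OF bB[of x y]] by simp_all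
  qed
  then have "symf d A'" "symf d B'" unfolding symf_iff_bform by blast+
  moreover have "(bform d A' x y)\<^sup>2 \<le> C1 * (dotp d x x * dotp d y y)"
    "(bform d B' x y)\<^sup>2 \<le> C2 * (dotp d x x * dotp d y y)" for x y
    by (rule LIMSEQ_le_const2[OF tendsto_power[OF bA]], use zS(3) in \<open>simp add: boundedf_def\<close>,
        rule LIMSEQ_le_const2[OF tendsto_power[OF bB]], use zS(4) in \<open>simp add: boundedf_def\<close>)
  then have "boundedf d C1 A'" "boundedf d C2 B'" unfolding boundedf_def by blast+
  moreover have "risk d n 1 A' 1 B' \<le> risk d n 1 A 1 B"
  proof -
    have "risk d n 1 A' 1 B' \<le> liminf (\<lambda>k. risk d n 1 (fst (z (r k))) 1 (snd (z (r k))))"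
      by (intro risk_liminf tendsto_const lA lB)
    also have "\<dots> \<le> liminf (\<lambda>k. risk d n 1 A 1 B)"
      by (intro Liminf_mono always_eventually allI zS(5))
    finally show ?thesis by (simp add: Liminf_const)
  qed
  ultimately have S': "(A', B') \<in> S" by (simp add: S_def)
  have trlim: "(\<lambda>k. tr (z (r k))) \<longlonglongrightarrow> tr (A', B')"
    unfolding tr_def case_prod_beta' fst_conv by (intro tendsto_intros lA; simp)
  have "(\<lambda>k. T - 1 / real (Suc k)) \<longlonglongrightarrow> T - 0"
    by (intro tendsto_intros LIMSEQ_inverse_real_of_nat[unfolded inverse_eq_divide])
  then have "(\<lambda>k. T - 1 / real (Suc (r k))) \<longlonglongrightarrow> T"
    using LIMSEQ_subseq_LIMSEQ[OF _ r] by (fastforce simp: o_def)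
  then have "T \<le> tr (A', B')"
    by (rule LIMSEQ_le[OF _ trlim]) (intro exI[of _ 0] allI impI less_imp_le z(2))
  \<comment> \<open>Otherwise a reflected pair would still lie in \<open>S\<close> but have weighted
    trace above the supremum \<open>T\<close>.\<close>
  have off: "A' p q = 0" if less: "p < q" "q < d" for p q
  proof (rule ccontr)
    assume nz: "A' p q \<noteq> 0"
    have sym: "A' p q = A' q p" using \<open>symf d A'\<close> that by (simp add: symf_def)
    obtain a b where ab: "a\<^sup>2 + b\<^sup>2 = 1" "a \<noteq> 0" "(\<Sum>i<d. real i * A' i i) < (\<Sum>i<d. real i * conj2 p q a b A' i i)"
      using weighted_trace_increase[OF less sym nz] by auto
    have pq: "p < d" "q < d" "p \<noteq> q" using that by auto
    have "(conj2 p q a b A', conj2 p q a b B') \<in> S"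
      using S' risk_conj2[OF pq ab(1,2)] by (simp add: S_def symf_conj2 boundedf_conj2 pq ab)
    then have "tr (conj2 p q a b A', conj2 p q a b B') \<le> T"
      unfolding T_def by (intro cSup_upper imageI bdd)
    then show False using ab(3) \<open>T \<le> tr (A', B')\<close> by (simp add: tr_def)
  qed
  have "A' i j = diagf (\<lambda>i. A' i i) i j" if "i < d" "j < d" for i j
    using off[of i j] off[of j i] that \<open>symf d A'\<close> by (cases i j rule: linorder_cases) (auto simp: diagf_def symf_def)
  then have "risk d n 1 (diagf (\<lambda>i. A' i i)) 1 B' = risk d n 1 A' 1 B'" by (intro risk_cong) auto
  then show ?thesis using \<open>risk d n 1 A' 1 B' \<le> _\<close> \<open>symf d B'\<close> by metis
qed

section \<open>Making the second matrix diagonal by averaging over sign flips\<close>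

lemma resid_average:
  "resid d n 1 A 1 (\<lambda>i j. (B i j + B' i j) / 2) \<omega> = (resid d n 1 A 1 B \<omega> + resid d n 1 A 1 B' \<omega>) / 2"
proof -
  have bf: "bform d (\<lambda>i j. (B i j + B' i j) / 2) x y = (bform d B x y + bform d B' x y) / 2" for x y
    by (simp add: bform_sum sum.distrib[symmetric] sum_divide_distrib algebra_simps add_divide_distrib)
  have av: "(\<Sum>c<n. f c * ((g c + h c) / 2)) = ((\<Sum>c<n. f c * g c) + (\<Sum>c<n. f c * h c)) / 2" for f g h :: "nat \<Rightarrow> real"
    by (simp add: sum.distrib[symmetric] sum_divide_distrib distrib_left)
  have comb: "P + k * Q + k * ((R + R') / 2) + m * ((W + W') / 2)
      = ((P + k * Q + k * R + m * W) + (P + k * Q + k * R' + m * W')) / 2" for P Q R R' W W' k m :: real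
    by (simp add: field_simps)
  show ?thesis unfolding resid_def Let_def bf av by (rule comb)
qed

text \<open>The residual is affine in the second family, so convexity of the square carries over to
  the integral.\<close>

lemma risk_average:
  "risk d n 1 A 1 (\<lambda>i j. (B i j + B' i j) / 2) \<le> ennreal (1/2) * (risk d n 1 A 1 B + risk d n 1 A 1 B')"
proof -
  have "((x + y) / 2)\<^sup>2 \<le> 1/2 * (x\<^sup>2 + y\<^sup>2)" for x y :: real
    using zero_le_power2[of "x - y"] by (simp add: power2_eq_square field_simps)
  then have "ennreal (((x + y) / 2)\<^sup>2) \<le> ennreal (1/2) * (ennreal (x\<^sup>2) + ennreal (y\<^sup>2))" for x y :: real
    by (metis ennreal_leI ennreal_mult ennreal_plus zero_le_power2 add_nonneg_nonneg zero_le_divide_1_iff zero_le_numeral)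
  then have "risk d n 1 A 1 (\<lambda>i j. (B i j + B' i j) / 2)
    \<le> (\<integral>\<^sup>+\<omega>. ennreal (1/2) * (ennreal ((resid d n 1 A 1 B \<omega>)\<^sup>2) + ennreal ((resid d n 1 A 1 B' \<omega>)\<^sup>2)) \<partial>gauss_space d n)"
    unfolding risk_def resid_average by (intro nn_integral_mono)
  also have "\<dots> = ennreal (1/2) * (risk d n 1 A 1 B + risk d n 1 A 1 B')"
    unfolding risk_def
    by (simp only: nn_integral_cmult nn_integral_add resid_sq_measurable borel_measurable_add)
  finally show ?thesis .
qed

text \<open>Flipping the sign of coordinate \<open>p\<close> fixes the diagonal first family and
  negates the off-diagonal entries of row and column \<open>p\<close> in \<open>B\<close>; averaging
  \<open>B\<close> with its flip removes them.\<close>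

lemma risk_clear_row_col:
  assumes p: "p < d"
  shows "risk d n 1 (diagf u) 1 (\<lambda>i j. if (i = p) \<noteq> (j = p) then 0 else B i j) \<le> risk d n 1 (diagf u) 1 B"
\<comment> \<open>A reflection needs a second index \<open>q\<close>. For \<open>d = 1\<close> there
  is none, but then there are no off-diagonal entries either.\<close>
proof (cases "d = 1")
  case True
  then show ?thesis using p by (intro eq_refl risk_cong) auto
next
  case False
  define q :: nat where "q = (if p = 0 then 1 else 0)"
  have pq: "p < d" "q < d" "p \<noteq> q" using p False by (auto simp: q_def)
  define B' where "B' = conj2 p q (-1) 0 B"
  have B': "B' i j = (if (i = p) \<noteq> (j = p) then - B i j else B i j)" for i j
    using pq by (auto simp: B'_def conj2_def refl2_def)
  have "conj2 p q (-1) 0 (diagf u) = diagf u"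
    using pq by (auto simp: conj2_def refl2_def diagf_def fun_eq_iff)
  then have eq: "risk d n 1 (diagf u) 1 B' = risk d n 1 (diagf u) 1 B"
    using risk_conj2[OF pq, of "-1" 0 n 1 "diagf u" 1 B] by (simp add: B'_def)
  have "(\<lambda>i j. if (i = p) \<noteq> (j = p) then 0 else B i j) = (\<lambda>i j. (B i j + B' i j) / 2)"
    by (auto simp: B' fun_eq_iff)
  have "risk d n 1 (diagf u) 1 (\<lambda>i j. if (i = p) \<noteq> (j = p) then 0 else B i j)
      \<le> ennreal (1/2) * (risk d n 1 (diagf u) 1 B + risk d n 1 (diagf u) 1 B')"
    unfolding \<open>_ = (\<lambda>i j. (B i j + B' i j) / 2)\<close> by (rule risk_average)
  also have "\<dots> = ennreal (1/2) * (2 * risk d n 1 (diagf u) 1 B)" unfolding eq by (simp add: mult_2)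
  also have "\<dots> = risk d n 1 (diagf u) 1 B"
  proof -
    have "ennreal (1/2) * 2 = ennreal (1/2 * 2)" by (subst ennreal_mult) auto
    then show ?thesis by (simp add: mult.assoc[symmetric])
  qed
  finally show ?thesis .
qed

lemma risk_diagonalize_second:
  "risk d n 1 (diagf u) 1 (diagf (\<lambda>i. B i i)) \<le> risk d n 1 (diagf u) 1 B"
proof -
  \<comment> \<open>Rows and columns are cleared one index at a time; \<open>m\<close> counts those
    already cleared.\<close>
  have "m \<le> d \<Longrightarrow> risk d n 1 (diagf u) 1 (\<lambda>i j. if i \<noteq> j \<and> (i < m \<or> j < m) then 0 else B i j) \<le> risk d n 1 (diagf u) 1 B" for m
  proof (induction m)
    case (Suc m)
    let ?B = "\<lambda>i j. if i \<noteq> j \<and> (i < m \<or> j < m) then 0 else B i j"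
    have "(\<lambda>i j. if i \<noteq> j \<and> (i < Suc m \<or> j < Suc m) then 0 else B i j)
       = (\<lambda>i j. if (i = m) \<noteq> (j = m) then 0 else ?B i j)"
      by (auto simp: fun_eq_iff less_Suc_eq)
    then have "risk d n 1 (diagf u) 1 (\<lambda>i j. if i \<noteq> j \<and> (i < Suc m \<or> j < Suc m) then 0 else B i j)
        \<le> risk d n 1 (diagf u) 1 ?B"
      using risk_clear_row_col[of m d n u ?B] Suc.prems by simp
    then show ?case using Suc by simp
  qed simp
  from this[of d] have "risk d n 1 (diagf u) 1 (\<lambda>i j. if i \<noteq> j \<and> (i < d \<or> j < d) then 0 else B i j) \<le> risk d n 1 (diagf u) 1 B"
    by simp
  moreover have "risk d n 1 (diagf u) 1 (\<lambda>i j. if i \<noteq> j \<and> (i < d \<or> j < d) then 0 else B i j)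
     = risk d n 1 (diagf u) 1 (diagf (\<lambda>i. B i i))"
    by (intro risk_cong) (auto simp: diagf_def)
  ultimately show ?thesis by simp
qed

section \<open>Comparison of the best diagonal pair with all symmetric pairs\<close>

theorem theorem2:
  fixes d n :: nat
  assumes "d \<ge> 1" and "n \<ge> 1"
  shows "\<exists>A0 A1. A0 \<in> carrier_mat d d \<and> A1 \<in> carrier_mat d d
           \<and> diagonal_mat A0 \<and> diagonal_mat A1
           \<and> (\<forall>B0 B1. B0 \<in> carrier_mat d d \<and> B0\<^sup>T = B0
                    \<and> B1 \<in> carrier_mat d d \<and> B1\<^sup>T = B1
                    \<longrightarrow> loss d n A0 A1 \<le> loss d n B0 B1)"
proof -
  obtain a b where min: "\<And>a' b'. risk d n 1 (diagf a) 1 (diagf b) \<le> risk d n 1 (diagf a') 1 (diagf b')"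
    using risk_diagf_minimizer[OF assms(2,1)] by blast
  let ?D = "\<lambda>u. mat d d (\<lambda>(i, j). diagf u i j)"
  have D: "loss d n (?D a) (?D b) = risk d n 1 (diagf a) 1 (diagf b)"
    unfolding loss_eq_risk[OF assms(2)] by (intro risk_cong) auto
  have sym: "symf d (\<lambda>i j. M $$ (i, j))" if "M \<in> carrier_mat d d" "M\<^sup>T = M" for M :: "real mat"
    using that unfolding symf_def by (metis carrier_matD index_transpose_mat(1))
  have "loss d n (?D a) (?D b) \<le> loss d n B0 B1"
    if B: "B0 \<in> carrier_mat d d" "B0\<^sup>T = B0" "B1 \<in> carrier_mat d d" "B1\<^sup>T = B1" for B0 B1
  proof -
    obtain u B' where "risk d n 1 (diagf u) 1 B' \<le> loss d n B0 B1"
      using risk_diagonalize_first[OF sym[OF B(1,2)] sym[OF B(3,4)]] unfolding loss_eq_risk[OF assms(2)] by blast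
    then show ?thesis
      unfolding D using min risk_diagonalize_second by (meson order_trans)
  qed
  moreover have "?D u \<in> carrier_mat d d" "diagonal_mat (?D u)" for u
    by (auto simp: diagonal_mat_def diagf_def)
  ultimately show ?thesis by blast
qed

end
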